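(* Let $\Omega \subset \mathbb{R}^2$ be a convex body with $0 \in \operatorname{int}\Omega$, and let $u:\Omega\to\mathbb{R}$ be a concave function of class $C^2$ (in the sense that $u$ is continuous on $\Omega$ and twice continuously differentiable in $\operatorname{int}\Omega$) such that $u=0$ on $\partial\Omega$. Assume that $0<\int_\Omega |\det D^2u|\,dx<\infty$, so that the quotient below is defined. Then for every triangle $T\subset\mathbb{R}^2$, $$ \frac{\frac{4}{27}|\Omega|\int_\Omega|\det D^2u|\,dx-\left(\sup_\Omega u\right)^2}{\frac{4}{27}|\Omega|\int_\Omega|\det D^2u|\,dx}\;\geq\;\frac{\delta_{BM}(\Omega,T)-1}{\delta_{BM}(\Omega,T)+899}. $$
   Context: A convex body in $\mathbb{R}^N$ is a non-empty, convex, compact subset of $\mathbb{R}^N$ with non-empty interior. $|E|$ denotes the Lebesgue measure of $E$, and $D^2u$ is the Hessian matrix of $u$; the integral over $\Omega$ is the integral over $\operatorname{int}\Omega$. A triangle means a non-degenerate (two-dimensional, closed, filled) triangle. For convex bodies $K,L\subset\mathbb{R}^N$ the Banach-Mazur distance is $$\delta_{BM}(K,L)=\inf\{t\ge 1 : \text{there exist an invertible affine map } A:\mathbb{R}^N\to\mathbb{R}^N \text{ and } x\in\mathbb{R}^N \text{ with } L\subset A(K)\subset tL+x\}.$$ *)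

theory Defs
  imports "HOL-Analysis.Analysis"
begin

definition convex_body :: "'a::euclidean_space set \<Rightarrow> bool" where
  "convex_body K \<longleftrightarrow> K \<noteq> {} \<and> convex K \<and> compact K \<and> interior K \<noteq> {}"

(* Collinearity is stated for the vertex set, so coinciding vertices are excluded as well. *)
definition is_triangle :: "(real^2) set \<Rightarrow> bool" where
  "is_triangle T \<longleftrightarrow> (\<exists>a b c. \<not> collinear {a, b, c} \<and> T = convex hull {a, b, c})"

definition invertible_affine :: "('a::real_vector \<Rightarrow> 'a) \<Rightarrow> bool" where
  "invertible_affine A \<longleftrightarrow> (\<exists>f b. linear f \<and> bij f \<and> A = (\<lambda>y. f y + b))"

definition banach_mazur_dist :: "'a::euclidean_space set \<Rightarrow> 'a set \<Rightarrow> real" where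
  "banach_mazur_dist K L =
     Inf {t. t \<ge> 1 \<and>
            (\<exists>A x. invertible_affine A \<and> L \<subseteq> A ` K \<and> A ` K \<subseteq> (\<lambda>y. t *\<^sub>R y + x) ` L)}"

(* Meaningful only at points where f is (Frechet) differentiable; C2_on guarantees this. *)
definition partial_deriv :: "'n::finite \<Rightarrow> (real^'n \<Rightarrow> real) \<Rightarrow> real^'n \<Rightarrow> real" where
  "partial_deriv i f x = frechet_derivative f (at x) (axis i 1)"

(* C1_on and C2_on are used for open U only, where differentiability within U and
   differentiability at the points of U coincide. *)
definition C1_on :: "(real^'n::finite \<Rightarrow> real) \<Rightarrow> (real^'n) set \<Rightarrow> bool" where
  "C1_on f U \<longleftrightarrow> f differentiable_on U \<and> (\<forall>i. continuous_on U (partial_deriv i f))"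

definition C2_on :: "(real^'n::finite \<Rightarrow> real) \<Rightarrow> (real^'n) set \<Rightarrow> bool" where
  "C2_on f U \<longleftrightarrow> C1_on f U \<and> (\<forall>i. C1_on (partial_deriv i f) U)"

definition hessian :: "(real^'n::finite \<Rightarrow> real) \<Rightarrow> real^'n \<Rightarrow> real^'n^'n" where
  "hessian f x = (\<chi> i j. partial_deriv i (partial_deriv j f) x)"

end

(*
  Let x0 maximise u and put M = u x0, K = Omega - x0. Every slope p with p.(x - x0) > -M on Omega is a
  gradient of u, so the area formula gives int |det D^2 u| >= M^2 |K*| with K* the polar body, and the
  claim reduces to a stable form of Mahler's inequality in the plane: with D the distance of K to a
  triangle, |K| |K*| >= 27/4 (1 + (D - 1) / 900).

  For this, a winding number argument produces boundary points A, B, C of K cutting off sectors whose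
  areas are c times those of the triangles OBC, OCA, OAB. The hexagon in K* spanned by touching normals
  at A, B, C and by the linear forms that equal 1/c on the sides of ABC has an area that multiplies with
  |K| to at least 27/4. The part of K* outside the hexagon contributes at least
  (1 - 1/c) (1 - rho) / 8, where rho K is contained in a triangle inscribed in K, so that D <= 1/rho.
  The starting direction can be chosen such that c >= 4/3 (or else |K| |K*| >= 8), and D <= 4 always;
  the constant 900 then leaves room to spare.
*)
theory Submission
  imports Defs "HOL-Complex_Analysis.Winding_Numbers"
begin

section \<open>Planar determinants, cones and sectors\<close>

text \<open>The touching normals at \<open>A\<close>, \<open>B\<close>, \<open>C\<close> lie on the
  edges of the triangle polar to \<open>ABC\<close>, so the hexagon has exactly 1/c times the area
  of that triangle wherever they sit, while |K| is c times the area of \<open>ABC\<close>. A common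
  c for the three sectors makes it cancel: what remains is the product of the areas of a triangle
  and of its polar, S^3 / (4 D1 D2 D3) with D1, D2, D3 the determinants of the three sides and S
  their sum, and AM-GM gives 27/4. The obstacle is the factor 1 - 1/c. If K is close to
  \<open>ABC\<close>, it is as small as 1 - rho, and the gain would be quadratic in the distance
  instead of linear. The starting direction is free, however, and restarting towards the midpoint of
  a side yields a second scale c' with c c' >= 2, so one of the two exceeds 4/3. The restart needs
  all barycentric coordinates of the origin in \<open>ABC\<close> below 1/2; otherwise AM-GM itself
  improves from 27/4 to 8. The constants 900 and 899 belong together: 1 + (D - 1)/900 = (D +
  899)/900, and 1 - 900/(D + 899) = (D - 1)/(D + 899).\<close>

definition det2 :: "real^2 \<Rightarrow> real^2 \<Rightarrow> real" where
  "det2 x y = x $ 1 * y $ 2 - x $ 2 * y $ 1"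

definition cone2 :: "real^2 \<Rightarrow> real^2 \<Rightarrow> (real^2) set" where
  "cone2 u v = {s *\<^sub>R u + t *\<^sub>R v | s t. 0 \<le> s \<and> 0 \<le> t}"

definition sector_area :: "(real^2) set \<Rightarrow> real^2 \<Rightarrow> real^2 \<Rightarrow> real" where
  "sector_area K u v = measure lebesgue (K \<inter> cone2 u v)"

definition polar :: "'a::real_inner set \<Rightarrow> 'a set" where
  "polar K = {n. \<forall>x\<in>K. n \<bullet> x \<le> 1}"

lemma inner_real2: "(x :: real^2) \<bullet> y = x $ 1 * y $ 1 + x $ 2 * y $ 2"
  by (simp add: inner_vec_def sum_2)

lemma real2_eq_iff: "(x :: real^2) = y \<longleftrightarrow> x $ 1 = y $ 1 \<and> x $ 2 = y $ 2"
  by (simp add: vec_eq_iff forall_2)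

lemma det2_self [simp]: "det2 x x = 0"
  by (simp add: det2_def)

lemma det2_zero [simp]: "det2 0 x = 0" "det2 x 0 = 0"
  by (simp_all add: det2_def)

lemma det2_commute: "det2 x y = - det2 y x"
  by (simp add: det2_def)

lemma det2_add: "det2 (x + y) z = det2 x z + det2 y z" "det2 z (x + y) = det2 z x + det2 z y"
  by (simp_all add: det2_def algebra_simps)

lemma det2_diff: "det2 (x - y) z = det2 x z - det2 y z" "det2 z (x - y) = det2 z x - det2 z y"
  by (simp_all add: det2_def algebra_simps)

lemma det2_scaleR: "det2 (s *\<^sub>R x) y = s * det2 x y" "det2 x (s *\<^sub>R y) = s * det2 x y"
  by (simp_all add: det2_def algebra_simps)

lemmas det2_linear = det2_add det2_diff det2_scaleR

lemma det2_expand: "det2 u v *\<^sub>R x = det2 x v *\<^sub>R u + det2 u x *\<^sub>R v"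
  by (simp add: real2_eq_iff det2_def algebra_simps)

lemma det2_expand':
  assumes "det2 u v \<noteq> 0"
  shows "x = (det2 x v / det2 u v) *\<^sub>R u + (det2 u x / det2 u v) *\<^sub>R v"
proof -
  have "x = (1 / det2 u v) *\<^sub>R (det2 u v *\<^sub>R x)"
    using assms by simp
  also have "\<dots> = (det2 x v / det2 u v) *\<^sub>R u + (det2 u x / det2 u v) *\<^sub>R v"
    by (subst det2_expand) (simp add: scaleR_add_right)
  finally show ?thesis .
qed

text \<open>Determinant of a matrix product (rows \<open>m\<close>, \<open>n\<close>, columns
  \<open>x\<close>, \<open>y\<close>). It turns areas in the polar plane into values of forms at
  points of \<open>K\<close>.\<close>

lemma det2_mult_det2: "det2 m n * det2 x y = (m \<bullet> x) * (n \<bullet> y) - (m \<bullet> y) * (n \<bullet> x)"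
  by (simp add: inner_real2 det2_def algebra_simps)

lemma eq_if_inner_eq:
  assumes "det2 x y \<noteq> 0" "m \<bullet> x = n \<bullet> x" "m \<bullet> y = n \<bullet> y"
  shows "m = n"
proof -
  have "(m - n) \<bullet> z = 0" for z
    using assms det2_expand' [OF assms(1), of z]
    by (metis (no_types, lifting) add.right_neutral inner_add_right inner_diff_left inner_scaleR_right mult_zero_right right_minus_eq)
  from this[of "m - n"] show ?thesis by simp
qed

lemma ex_inner_eq:
  assumes "det2 x y \<noteq> 0"
  obtains m where "m \<bullet> x = \<alpha>" "m \<bullet> y = \<beta>"
proof
  let ?m = "vector [(\<alpha> * y $ 2 - \<beta> * x $ 2) / det2 x y, (\<beta> * x $ 1 - \<alpha> * y $ 1) / det2 x y] :: real^2"
  show "?m \<bullet> x = \<alpha>" "?m \<bullet> y = \<beta>"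
    using assms by (simp_all add: inner_real2 divide_simps) (simp_all add: det2_def algebra_simps)
qed

lemma cone2I: "0 \<le> s \<Longrightarrow> 0 \<le> t \<Longrightarrow> s *\<^sub>R u + t *\<^sub>R v \<in> cone2 u v"
  by (auto simp: cone2_def)

lemma cone2E:
  assumes "x \<in> cone2 u v"
  obtains s t where "0 \<le> s" "0 \<le> t" "x = s *\<^sub>R u + t *\<^sub>R v"
  using assms by (auto simp: cone2_def)

lemma cone2_commute: "cone2 u v = cone2 v u"
proof -
  have "cone2 a b \<subseteq> cone2 b a" for a b :: "real^2"
    unfolding cone2_def using add.commute by blast
  then show ?thesis by blast
qed

lemma convex_cone2: "convex (cone2 u v)"
proof (rule convexI)
  fix x y and a b :: real
  assume "x \<in> cone2 u v" "y \<in> cone2 u v" and ab: "0 \<le> a" "0 \<le> b" "a + b = 1"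
  then obtain s t s' t' where "0 \<le> s" "0 \<le> t" "x = s *\<^sub>R u + t *\<^sub>R v"
      and "0 \<le> s'" "0 \<le> t'" "y = s' *\<^sub>R u + t' *\<^sub>R v"
    by (auto elim!: cone2E)
  moreover from this have "a *\<^sub>R x + b *\<^sub>R y = (a * s + b * s') *\<^sub>R u + (a * t + b * t') *\<^sub>R v"
    by (simp add: algebra_simps)
  ultimately show "a *\<^sub>R x + b *\<^sub>R y \<in> cone2 u v"
    using ab by (metis add_nonneg_nonneg cone2I mult_nonneg_nonneg)
qed

lemma cone2_subset:
  assumes "a \<in> cone2 u v" "b \<in> cone2 u v"
  shows "cone2 a b \<subseteq> cone2 u v"
proof
  fix x assume "x \<in> cone2 a b"
  then obtain s t where st: "0 \<le> s" "0 \<le> t" "x = s *\<^sub>R a + t *\<^sub>R b"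
    by (rule cone2E)
  from assms obtain p q p' q' where "0 \<le> p" "0 \<le> q" "a = p *\<^sub>R u + q *\<^sub>R v"
      and "0 \<le> p'" "0 \<le> q'" "b = p' *\<^sub>R u + q' *\<^sub>R v"
    by (auto elim!: cone2E)
  moreover from this st have "x = (s * p + t * p') *\<^sub>R u + (s * q + t * q') *\<^sub>R v"
    by (simp add: algebra_simps)
  ultimately show "x \<in> cone2 u v"
    using st by (metis add_nonneg_nonneg cone2I mult_nonneg_nonneg)
qed

lemma cone2_left: "u \<in> cone2 u v"
  using cone2I[of 1 0 u v] by simp

lemma cone2_right: "v \<in> cone2 u v"
  using cone2I[of 0 1 u v] by simp

lemma sector_lmeasurable: "convex K \<Longrightarrow> bounded K \<Longrightarrow> K \<inter> cone2 u v \<in> lmeasurable"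
  by (intro measurable_convex convex_Int convex_cone2 bounded_Int) auto

lemma sector_area_commute: "sector_area K u v = sector_area K v u"
  by (simp add: sector_area_def cone2_commute)

lemma negligible_det2:
  assumes "m \<noteq> 0" "\<And>x. x \<in> S \<Longrightarrow> det2 m x = 0"
  shows "negligible S"
proof (rule negligible_subset)
  let ?n = "vector [- (m $ 2), m $ 1] :: real^2"
  show "negligible {x. ?n \<bullet> x = 0}"
    using assms(1) by (intro negligible_hyperplane) (auto simp: real2_eq_iff)
  show "S \<subseteq> {x. ?n \<bullet> x = 0}"
    using assms(2) by (auto simp: det2_def inner_real2)
qed

lemma measure_Un_negligible_Int:
  assumes "A \<in> lmeasurable" "B \<in> lmeasurable" "negligible (A \<inter> B)"
  shows "measure lebesgue A + measure lebesgue B = measure lebesgue (A \<union> B)"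
  using assms measure_Un3_negligible[of A B "{}"] by simp

lemma sector_area_split:
  assumes "convex K" "bounded K" "m \<noteq> 0" "m \<in> cone2 u v"
  shows "sector_area K u m + sector_area K m v \<le> sector_area K u v"
proof -
  from assms(4) obtain x y where xy: "0 \<le> x" "0 \<le> y" "m = x *\<^sub>R u + y *\<^sub>R v"
    by (rule cone2E)
  have "negligible ((K \<inter> cone2 u m) \<inter> (K \<inter> cone2 m v))"
  proof (rule negligible_det2 [OF assms(3)])
    fix z assume "z \<in> (K \<inter> cone2 u m) \<inter> (K \<inter> cone2 m v)"
    then obtain s t s' t' where z: "0 \<le> s" "0 \<le> t" "z = s *\<^sub>R u + t *\<^sub>R m"
        "0 \<le> s'" "0 \<le> t'" "z = s' *\<^sub>R m + t' *\<^sub>R v"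
      by (auto elim!: cone2E)
    \<comment> \<open>The two cones lie on opposite sides of the line through \<open>m\<close>, so
      the two expressions for \<open>det2 m z\<close> cannot agree unless both vanish.\<close>
    have 1: "det2 m z = - (s * y) * det2 u v"
      unfolding z(3) using xy(3) by (simp add: det2_linear det2_commute[of v u])
    have 2: "det2 m z = t' * x * det2 u v"
      unfolding z(6) using xy(3) by (simp add: det2_linear)
    show "det2 m z = 0"
    proof (rule ccontr)
      assume "det2 m z \<noteq> 0"
      with 1 2 have "t' * x * det2 u v = - (s * y) * det2 u v" "s * y \<noteq> 0" "det2 u v \<noteq> 0" by auto
      then have "t' * x = - (s * y)" "s * y \<noteq> 0" by (metis mult_cancel_right)+
      moreover have "0 \<le> t' * x" "0 \<le> s * y" using xy z by auto
      ultimately show False by linarith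
    qed
  qed
  then have "measure lebesgue (K \<inter> cone2 u m) + measure lebesgue (K \<inter> cone2 m v)
      = measure lebesgue ((K \<inter> cone2 u m) \<union> (K \<inter> cone2 m v))"
    by (intro measure_Un_negligible_Int sector_lmeasurable assms)
  also have "\<dots> \<le> measure lebesgue (K \<inter> cone2 u v)"
    using cone2_subset[OF cone2_left assms(4)] cone2_subset[OF assms(4) cone2_right]
      sector_lmeasurable[OF assms(1,2)]
    by (intro measure_mono_fmeasurable fmeasurableD fmeasurable.Un) auto
  finally show ?thesis
    by (simp add: sector_area_def)
qed

text \<open>The scalars allow cones spanned by directions outside \<open>K\<close>; for the polar
  body, \<open>a\<close> and \<open>m\<close> are such directions and only suitable multiples of
  them belong to it.\<close>

lemma sector_area_ge_triangle:
  assumes "convex K" "bounded K" "0 \<in> K" "s *\<^sub>R u \<in> K" "t *\<^sub>R v \<in> K" "0 \<le> s" "0 \<le> t"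
  shows "s * t * \<bar>det2 u v\<bar> / 2 \<le> sector_area K u v"
proof -
  have "measure lebesgue (convex hull {0, s *\<^sub>R u, t *\<^sub>R v}) \<le> sector_area K u v"
    unfolding sector_area_def
  proof (rule measure_mono_fmeasurable)
    show "convex hull {0, s *\<^sub>R u, t *\<^sub>R v} \<subseteq> K \<inter> cone2 u v"
      using assms cone2I[of 0 0 u v] cone2I[of s 0 u v] cone2I[of 0 t u v]
      by (intro hull_minimal convex_Int convex_cone2) auto
    show "convex hull {0, s *\<^sub>R u, t *\<^sub>R v} \<in> sets lebesgue"
      by (intro fmeasurableD lmeasurable_compact compact_convex_hull) auto
  qed (rule sector_lmeasurable[OF assms(1,2)])
  also have "measure lebesgue (convex hull {0, s *\<^sub>R u, t *\<^sub>R v}) = s * t * \<bar>det2 u v\<bar> / 2"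
  proof -
    have "measure lebesgue (convex hull {0, s *\<^sub>R u, t *\<^sub>R v}) =
        measure lborel (convex hull {0, s *\<^sub>R u, t *\<^sub>R v})"
      by (intro measure_completion) (auto intro!: borel_compact compact_convex_hull)
    also have "\<dots> = \<bar>s * t * det2 u v\<bar> / 2"
      by (subst content_triangle) (simp add: det2_def algebra_simps)
    finally show ?thesis
      using assms by (simp add: abs_mult)
  qed
  finally show ?thesis .
qed

text \<open>The positive relation gives the three cyclic determinants one sign, so neighbouring
  cones lie on opposite sides of their common ray and overlap in a null set.\<close>

lemma sector_area_three:
  assumes "convex K" "bounded K" "det2 a b \<noteq> 0" "0 < r" "0 < s" "0 < t"
    and 0: "r *\<^sub>R a + s *\<^sub>R b + t *\<^sub>R c = 0"
  shows "sector_area K a b + sector_area K b c + sector_area K c a \<le> measure lebesgue K"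
proof -
  have "t *\<^sub>R c = - (r *\<^sub>R a + s *\<^sub>R b)"
    using 0 by (metis add.commute eq_neg_iff_add_eq_0)
  then have "det2 b (t *\<^sub>R c) = det2 b (- (r *\<^sub>R a + s *\<^sub>R b))"
    "det2 (t *\<^sub>R c) a = det2 (- (r *\<^sub>R a + s *\<^sub>R b)) a"
    by simp_all
  then have "t * det2 b c = r * det2 a b" "t * det2 c a = s * det2 a b"
    by (simp_all add: det2_def algebra_simps)
  then have abc: "det2 b c = r / t * det2 a b" "det2 c a = s / t * det2 a b"
    using \<open>0 < t\<close> by (simp_all add: field_simps)
  have nz: "a \<noteq> 0" "b \<noteq> 0" "c \<noteq> 0"
    using assms abc by auto
  have neg: "negligible ((K \<inter> cone2 u v) \<inter> (K \<inter> cone2 v w))"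
    if "v \<noteq> 0" "det2 u v * det2 v w > 0" for u v w
  proof (rule negligible_det2 [OF that(1)])
    fix z assume "z \<in> (K \<inter> cone2 u v) \<inter> (K \<inter> cone2 v w)"
    then obtain s t s' t' where z: "0 \<le> s" "0 \<le> t" "z = s *\<^sub>R u + t *\<^sub>R v"
        "0 \<le> s'" "0 \<le> t'" "z = s' *\<^sub>R v + t' *\<^sub>R w"
      by (auto elim!: cone2E)
    have 1: "det2 v z = - s * det2 u v"
      unfolding z(3) by (simp add: det2_linear det2_commute[of v u])
    have 2: "det2 v z = t' * det2 v w"
      unfolding z(6) by (simp add: det2_linear)
    have "det2 v z * det2 v z = - (s * t') * (det2 u v * det2 v w)"
      by (subst (1) 1, subst 2) simp
    also have "\<dots> \<le> 0" using z that by simp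
    finally show "det2 v z = 0"
      by (meson mult_eq_0_iff not_square_less_zero order_antisym_conv zero_le_square)
  qed
  have "det2 a b * det2 a b > 0"
    using assms(3) by (metis not_real_square_gt_zero)
  moreover have "det2 a b * det2 b c = r / t * (det2 a b * det2 a b)"
    "det2 b c * det2 c a = r / t * (s / t) * (det2 a b * det2 a b)"
    "det2 c a * det2 a b = s / t * (det2 a b * det2 a b)"
    by (simp_all only: abc mult_ac)
  ultimately have pos: "det2 a b * det2 b c > 0" "det2 b c * det2 c a > 0" "det2 c a * det2 a b > 0"
    using assms(4-6) by (metis divide_pos_pos mult_pos_pos)+
  have "negligible (((K \<inter> cone2 a b) \<union> (K \<inter> cone2 b c)) \<inter> (K \<inter> cone2 c a))"
    unfolding Int_Un_distrib2
    using neg[OF nz(3) pos(2)] neg[OF nz(1) pos(3)] by (intro negligible_Un) (simp_all only: Int_commute)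
  then have "measure lebesgue (K \<inter> cone2 a b) + measure lebesgue (K \<inter> cone2 b c) + measure lebesgue (K \<inter> cone2 c a)
      = measure lebesgue ((K \<inter> cone2 a b) \<union> (K \<inter> cone2 b c) \<union> (K \<inter> cone2 c a))"
    using neg[OF nz(2) pos(1)]
    by (simp only: measure_Un_negligible_Int sector_lmeasurable[OF assms(1,2)] fmeasurable.Un)
  also have "\<dots> \<le> measure lebesgue K"
    using sector_lmeasurable[OF assms(1,2)] measurable_convex[OF assms(1,2)]
    by (intro measure_mono_fmeasurable fmeasurableD fmeasurable.Un) auto
  finally show ?thesis
    by (simp add: sector_area_def)
qed

section \<open>Polar bodies and the area gain in a sector\<close>

lemma convex_polar: "convex (polar K)"
proof -
  have "polar K = (\<Inter>x\<in>K. {n. x \<bullet> n \<le> 1})"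
    by (auto simp: polar_def inner_commute)
  then show ?thesis
    by (simp add: convex_INT convex_halfspace_le)
qed

lemma closed_polar: "closed (polar K)"
proof -
  have "polar K = (\<Inter>x\<in>K. {n. x \<bullet> n \<le> 1})"
    by (auto simp: polar_def inner_commute)
  then show ?thesis
    by (simp add: closed_INT closed_halfspace_le)
qed

lemma zero_in_polar: "0 \<in> polar K"
  by (simp add: polar_def)

lemma bounded_polar:
  fixes K :: "'a::real_inner set"
  assumes "0 \<in> interior K"
  shows "bounded (polar K)"
proof -
  from assms obtain r where r: "0 < r" "cball 0 r \<subseteq> K"
    by (meson interior_subset mem_interior_cball)
  have "norm n \<le> 1 / r" if "n \<in> polar K" for n
  proof (cases "n = 0")
    case False
    then have "(r / norm n) *\<^sub>R n \<in> K"
      using r by (intro subsetD[OF r(2)]) simp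
    with that have "n \<bullet> ((r / norm n) *\<^sub>R n) \<le> 1"
      by (auto simp: polar_def)
    moreover have "n \<bullet> ((r / norm n) *\<^sub>R n) = r * norm n"
      using False by (simp add: power2_norm_eq_inner[symmetric] power2_eq_square)
    ultimately show ?thesis
      using r by (simp add: field_simps)
  qed (use r in simp)
  then show ?thesis
    by (auto simp: bounded_iff)
qed

lemma compact_polar: "0 \<in> interior K \<Longrightarrow> compact (polar (K :: 'a::euclidean_space set))"
  by (simp add: compact_eq_bounded_closed bounded_polar closed_polar)

lemma polar_scale_mem:
  assumes "0 < s" "\<And>x. x \<in> K \<Longrightarrow> a \<bullet> x \<le> s"
  shows "(1 / s) *\<^sub>R a \<in> polar K"
  using assms by (auto simp: polar_def field_simps)

text \<open>
  The triangle \<open>OAB\<close> has area \<open>t\<close> and the sector of \<open>K\<close> over it area at most \<open>k = c t\<close>. The points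
  \<open>As\<close>, \<open>a / c\<close>, \<open>Bs\<close> of the polar body span area \<open>(\<sigma> det2 As a + \<sigma> det2 a Bs) / (2 c)\<close>, and \<open>G\<close> is the
  area of the polar sector in excess of that. Two further polar points force \<open>G\<close> up: \<open>a / (a \<bullet> q)\<close>, and
  \<open>m / M\<close>, where \<open>m\<close> is dual to the line \<open>Aq\<close> and \<open>M\<close> is close to 1 because the part of the sector
  outside the quadrilateral \<open>OAqB\<close> has small area. The sign \<open>\<sigma>\<close> gives the statement for \<open>A\<close> and for \<open>B\<close>
  at once.
\<close>

lemma sector_gain:
  fixes K :: "(real^2) set" and \<sigma> c k :: real
  defines "C \<equiv> polar K"
  assumes K: "convex K" "compact K" "0 \<in> interior K"
    and \<sigma>: "\<sigma> = 1 \<or> \<sigma> = -1"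
    and A: "A \<in> K" "As \<in> C" "As \<bullet> A = 1"
    and B: "B \<in> K" "Bs \<in> C" "Bs \<bullet> B = 1"
    and D: "0 < \<sigma> * det2 A B"
    and k: "sector_area K A B \<le> k" "k = c * (\<sigma> * det2 A B / 2)"
    and a: "a \<bullet> A = 1" "a \<bullet> B = 1"
    and q: "q \<in> K" "q \<in> cone2 A B" "\<And>x. x \<in> K \<Longrightarrow> a \<bullet> x \<le> a \<bullet> q"
  defines "G \<equiv> sector_area C As a + sector_area C a Bs
      - (\<sigma> * det2 As a + \<sigma> * det2 a Bs) / (2 * c)"
  shows "(1 - As \<bullet> q) * (1 - 1 / c) \<le> 8 * k * G"
proof -
  define t where "t = \<sigma> * det2 A B / 2"
  define h where "h = a \<bullet> q"
  define \<rho> where "\<rho> = As \<bullet> q"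
  define N1 where "N1 = sector_area C As a"
  define N2 where "N2 = sector_area C a Bs"
  define eB where "eB = \<sigma> * det2 a Bs"
  define b where "b = (\<sigma> * det2 As a + eB) / (2 * c)"
  have GN: "G = N1 + N2 - b"
    by (simp add: G_def N1_def N2_def eB_def b_def)
  have \<sigma>2: "\<sigma> * \<sigma> = 1" and \<sigma>abs: "\<sigma> * x \<le> \<bar>x\<bar>" for x
    using \<sigma> by auto
  have t: "0 < t" and kt: "k = c * t" using D k by (auto simp: t_def)
  have 0: "0 \<in> K" using K interior_subset by blast
  have bK: "bounded K" using K compact_imp_bounded by blast
  have C: "convex C" "bounded C" "0 \<in> C"
    using K by (auto simp: C_def convex_polar bounded_polar zero_in_polar)
  have tri: "\<sigma> * det2 u v / 2 \<le> sector_area K u v" if "u \<in> K" "v \<in> K" for u v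
    using sector_area_ge_triangle[OF K(1) bK 0, of 1 u 1 v] that \<sigma>abs[of "det2 u v"] by simp
  have triC: "x * y * (\<sigma> * det2 u v) / 2 \<le> sector_area C u v"
    if "x *\<^sub>R u \<in> C" "y *\<^sub>R v \<in> C" "0 \<le> x" "0 \<le> y" for u v x y
    using sector_area_ge_triangle[OF C, of x u y v] that
      mult_left_mono[OF \<sigma>abs[of "det2 u v"], of "x * y"] by simp
  obtain \<alpha> \<beta> where \<alpha>\<beta>: "0 \<le> \<alpha>" "0 \<le> \<beta>" and qeq: "q = \<alpha> *\<^sub>R A + \<beta> *\<^sub>R B"
    using q(2) by (rule cone2E)
  have h\<alpha>\<beta>: "h = \<alpha> + \<beta>" using a by (simp add: h_def qeq inner_add_right)
  have h1: "1 \<le> h" using q(3)[OF A(1)] a by (simp add: h_def)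
  have \<rho>1: "\<rho> \<le> 1" using A(2) q(1) by (auto simp: \<rho>_def C_def polar_def)
  define w where "w = \<sigma> * det2 A q / 2"
  have w\<beta>: "w = \<beta> * t" by (simp add: w_def qeq t_def det2_linear)
  have w0: "0 \<le> w" using \<alpha>\<beta> t w\<beta> by simp
  have qB: "\<sigma> * det2 q B / 2 = h * t - w"
    by (simp add: w\<beta> qeq t_def h\<alpha>\<beta> det2_linear algebra_simps)
  have q0: "q \<noteq> 0" using h1 by (auto simp: h_def)
  have Ssplit: "sector_area K A q + sector_area K q B \<le> k"
    using sector_area_split[OF K(1) bK q0 q(2)] k(1) by linarith
  \<comment> \<open>\<open>h * t\<close> is the area of the quadrilateral \<open>OAqB\<close>, which
    lies in the sector. Hence \<open>h \<le> c\<close>, and both \<open>a / h\<close> and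
    \<open>a / c\<close> are polar points.\<close>
  have ht: "h * t \<le> k"
    using Ssplit tri[OF A(1) q(1)] tri[OF q(1) B(1)] qB w_def by linarith
  have hc: "h \<le> c" using ht t by (simp add: kt)
  have c: "1 \<le> c" "0 < c" using h1 hc by auto
  have n: "(1 / h) *\<^sub>R a \<in> C"
    unfolding C_def by (rule polar_scale_mem) (use h1 q(3) h_def in auto)
  have p: "(1 / c) *\<^sub>R a \<in> C"
    unfolding C_def using c q(3) hc h_def by (intro polar_scale_mem) (auto intro: order_trans)
  have BA: "Bs \<bullet> A \<le> 1" using B A by (auto simp: C_def polar_def)
  have eB0: "0 \<le> eB"
  proof -
    have *: "det2 a Bs * det2 A B = 1 - Bs \<bullet> A"
      using det2_mult_det2[of a Bs A B] a B by (simp add: inner_commute)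
    then have "eB * (2 * t) = 1 - Bs \<bullet> A"
    proof -
      have "eB * (2 * t) = (\<sigma> * \<sigma>) * (det2 a Bs * det2 A B)"
        by (simp add: eB_def t_def)
      with * show ?thesis by (simp add: \<sigma>2)
    qed
    then have "eB = (1 - Bs \<bullet> A) / (2 * t)" using t by (simp add: field_simps)
    then show ?thesis using t BA by simp
  qed
  have N2c: "eB / (2 * c) \<le> N2" and N2h: "eB / (2 * h) \<le> N2"
    using triC[of "1/c" a 1 Bs] triC[of "1/h" a 1 Bs] p n B c h1 by (simp_all add: eB_def N2_def)
  have N1c: "\<sigma> * det2 As a / (2 * c) \<le> N1" and N1h: "\<sigma> * det2 As a / (2 * h) \<le> N1"
    using triC[of 1 As "1/c" a] triC[of 1 As "1/h" a] p n A c h1 by (simp_all add: N1_def)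
  have G0: "0 \<le> G"
    using N1c N2c by (simp add: GN b_def add_divide_distrib)
  have k0: "0 < k" using c t kt by simp
  show ?thesis
  proof (cases "w = 0")
    \<comment> \<open>Here \<open>q\<close> lies on the ray through \<open>A\<close>, so
      \<open>\<rho> = h \<ge> 1\<close> and the left-hand side is nonpositive.\<close>
    case True
    then have "\<beta> = 0" using w\<beta> t by simp
    then have "\<rho> = h" using h\<alpha>\<beta> A by (simp add: \<rho>_def qeq inner_add_right)
    then have "(1 - \<rho>) * (1 - 1 / c) \<le> 0"
      using h1 c by (intro mult_nonpos_nonneg) auto
    also have "0 \<le> 8 * k * G" using k0 G0 by simp
    finally show ?thesis by (simp add: \<rho>_def)
  next
    case False
    then have w: "0 < w" using w0 by simp
    then have Aq: "det2 A q \<noteq> 0" using w_def by auto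
    obtain m where m: "m \<bullet> A = 1" "m \<bullet> q = 1" using ex_inner_eq[OF Aq] .
    \<comment> \<open>For \<open>x\<close> in the cone over \<open>Aq\<close>, the triangles
      \<open>OAx\<close> and \<open>Oxq\<close> have total area \<open>w * (m \<bullet> x)\<close>.
      Together with \<open>OqB\<close>, of area \<open>h * t - w\<close>, they fit into the sector
      of area at most \<open>k\<close>, which bounds \<open>m \<bullet> x\<close> by
      \<open>M\<close>.\<close>
    define M where "M = 1 + (k - h * t) / w"
    have M1: "1 \<le> M" using ht w by (simp add: M_def)
    have mM: "m \<bullet> x \<le> M" if x: "x \<in> K" for x
    proof -
      define \<xi> \<eta> where "\<xi> = det2 x q / det2 A q" and "\<eta> = det2 A x / det2 A q"
      have xeq: "x = \<xi> *\<^sub>R A + \<eta> *\<^sub>R q" unfolding \<xi>_def \<eta>_def by (rule det2_expand'[OF Aq])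
      have mx: "m \<bullet> x = \<xi> + \<eta>" using m by (simp add: xeq inner_add_right)
      \<comment> \<open>Outside that cone the support lines at \<open>q\<close> (given by
        \<open>a\<close>) and at \<open>A\<close> (given by \<open>As\<close>) even yield
        \<open>m \<bullet> x \<le> 1\<close>.\<close>
      consider "0 \<le> \<xi>" "0 \<le> \<eta>" | "\<xi> < 0" | "\<eta> < 0" by linarith
      then show ?thesis
      proof cases
        case 1
        then have xc: "x \<in> cone2 A q" unfolding xeq by (rule cone2I)
        show ?thesis
        proof (cases "x = 0")
          case True then show ?thesis using M1 by simp
        next
          case False
          have "\<sigma> * det2 A x / 2 + \<sigma> * det2 x q / 2 = w * (m \<bullet> x)"
            unfolding mx by (simp add: w_def xeq det2_linear algebra_simps)
          moreover have "\<sigma> * det2 A x / 2 + \<sigma> * det2 x q / 2 \<le> sector_area K A q"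
            using tri[OF A(1) x] tri[OF x q(1)] sector_area_split[OF K(1) bK False xc] by linarith
          ultimately have "w * (m \<bullet> x) + (h * t - w) \<le> k"
            using Ssplit tri[OF q(1) B(1)] qB by linarith
          then show ?thesis using w by (simp add: M_def field_simps)
        qed
      next
        case 2
        have "a \<bullet> x \<le> h" using q(3)[OF x] by (simp add: h_def)
        then have "\<xi> + \<eta> * h \<le> h" using a by (simp add: xeq inner_add_right h_def)
        then have "(\<xi> + \<eta>) * h \<le> h + \<xi> * (h - 1)" by (simp add: algebra_simps)
        also have "\<dots> \<le> h" using 2 h1 by (simp add: mult_nonpos_nonneg)
        finally have "\<xi> + \<eta> \<le> 1" using h1 by simp
        then show ?thesis using mx M1 by linarith
      next
        case 3
        have "As \<bullet> x \<le> 1" using A(2) x by (auto simp: C_def polar_def)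
        then have "\<xi> + \<eta> * \<rho> \<le> 1" using A by (simp add: xeq inner_add_right \<rho>_def)
        then have "\<xi> + \<eta> \<le> 1 + \<eta> * (1 - \<rho>)" by (simp add: algebra_simps)
        also have "\<dots> \<le> 1" using 3 \<rho>1 by (simp add: mult_nonpos_nonneg)
        finally show ?thesis using mx M1 by linarith
      qed
    qed
    have mC: "(1 / M) *\<^sub>R m \<in> C"
      unfolding C_def by (rule polar_scale_mem) (use M1 mM in auto)
    have dual: "\<sigma> * det2 u v = ((u \<bullet> A) * (v \<bullet> q) - (u \<bullet> q) * (v \<bullet> A)) / (2 * w)" for u v
    proof -
      have "\<sigma> * det2 u v * (2 * w) = (\<sigma> * \<sigma>) * (det2 u v * det2 A q)"
        by (simp add: w_def)
      also have "\<dots> = (u \<bullet> A) * (v \<bullet> q) - (u \<bullet> q) * (v \<bullet> A)"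
        by (simp add: \<sigma>2 det2_mult_det2)
      finally show ?thesis using w by (simp add: field_simps)
    qed
    have dAm: "\<sigma> * det2 As m = (1 - \<rho>) / (2 * w)" and dma: "\<sigma> * det2 m a = (h - 1) / (2 * w)"
      and dAa: "\<sigma> * det2 As a = (h - \<rho>) / (2 * w)"
      using dual m a A by (simp_all add: \<rho>_def h_def)
    have m0: "m \<noteq> 0" using m by auto
    \<comment> \<open>\<open>As\<close>, \<open>m\<close> and \<open>a\<close> all take the value 1
      at \<open>A\<close>, hence are collinear; at \<open>q\<close> the value 1 of \<open>m\<close>
      lies between \<open>\<rho>\<close> and \<open>h\<close>.\<close>
    have mcone: "m \<in> cone2 As a"
    proof (cases "h = \<rho>")
      case True
      then have "\<rho> = 1" using h1 \<rho>1 by simp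
      then have "m = As" using m A by (intro eq_if_inner_eq[OF Aq]) (auto simp: \<rho>_def)
      then show ?thesis by (simp add: cone2_left)
    next
      case False
      then have h\<rho>: "0 < h - \<rho>" using h1 \<rho>1 by linarith
      have "(h - 1) / (h - \<rho>) + (1 - \<rho>) / (h - \<rho>) = (h - \<rho>) / (h - \<rho>)"
        "(h - 1) / (h - \<rho>) * \<rho> + (1 - \<rho>) / (h - \<rho>) * h = (h - \<rho>) / (h - \<rho>)"
        by (simp_all add: algebra_simps flip: add_divide_distrib diff_divide_distrib)
      then have "m = ((h - 1) / (h - \<rho>)) *\<^sub>R As + ((1 - \<rho>) / (h - \<rho>)) *\<^sub>R a"
        using m A a h\<rho> by (intro eq_if_inner_eq[OF Aq])
          (simp_all add: inner_add_left flip: \<rho>_def h_def)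
      then show ?thesis using h1 \<rho>1 h\<rho> by (metis cone2I diff_ge_0_iff_ge divide_nonneg_pos)
    qed
    have "(1 / M) * (\<sigma> * det2 As m) / 2 + (1 / M) * (1 / c) * (\<sigma> * det2 m a) / 2 \<le> N1"
      using triC[of 1 As "1/M" m] triC[of "1/M" m "1/c" a] A mC p c M1
        sector_area_split[OF C(1,2) m0 mcone] by (simp add: N1_def)
    then have N1M: "(\<sigma> * det2 As m) / 2 + (\<sigma> * det2 m a) / (2 * c) \<le> M * N1"
      using M1 by (simp add: field_simps)
    have N2M: "eB / (2 * c) \<le> M * N2"
    proof -
      have "0 \<le> N2" by (simp add: N2_def sector_area_def)
      then have "N2 \<le> M * N2" using M1 mult_right_mono[of 1 M N2] by simp
      then show ?thesis using N2c by linarith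
    qed
    \<comment> \<open>Area by which the quadrilateral \<open>0\<close>, \<open>As\<close>,
      \<open>m\<close>, \<open>a / c\<close> exceeds the triangle \<open>0\<close>,
      \<open>As\<close>, \<open>a / c\<close> counted in \<open>b\<close>.\<close>
    define X where "X = (1 - \<rho>) * (1 - 1 / c) / (4 * w)"
    have "(\<sigma> * det2 As m) / 2 + (\<sigma> * det2 m a) / (2 * c) + eB / (2 * c) = b + X"
      unfolding dAm dma b_def dAa X_def using w c by (simp add: field_simps)
    then have MN: "b + X \<le> M * (N1 + N2)"
      using N1M N2M by (simp add: distrib_left)
    \<comment> \<open>The loss caused by \<open>M > 1\<close> is itself controlled by
      \<open>G\<close>: the polar point \<open>a / h\<close> gives
      \<open>(c - h) * (N1 + N2) \<le> c * G\<close>.\<close>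
    have "(\<sigma> * det2 As a + eB) / (2 * h) \<le> N1 + N2"
      using N1h N2h by (simp add: add_divide_distrib)
    then have "(\<sigma> * det2 As a + eB) / 2 \<le> h * (N1 + N2)" using h1 by (simp add: field_simps)
    moreover have "c * b = (\<sigma> * det2 As a + eB) / 2" using c by (simp add: b_def)
    ultimately have hN: "c * b \<le> h * (N1 + N2)" by simp
    have "M * (N1 + N2) = N1 + N2 + (c - h) * (N1 + N2) * t / w"
      using w by (simp add: M_def kt field_simps)
    also have "(c - h) * (N1 + N2) * t / w \<le> (c * G) * t / w"
      using hN t w by (intro divide_right_mono mult_right_mono) (auto simp: GN algebra_simps)
    also have "(c * G) * t / w = k * G / w" by (simp add: kt)
    finally have "X \<le> G + k * G / w" using MN GN by linarith
    then have "X * w \<le> G * (w + k)" using w by (simp add: field_simps)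
    also have "\<dots> \<le> G * (2 * k)"
    proof -
      have "0 \<le> \<alpha> * t" using \<alpha>\<beta> t by simp
      then have "w \<le> h * t" by (simp add: w\<beta> h\<alpha>\<beta> algebra_simps)
      then show ?thesis using ht G0 by (intro mult_left_mono) auto
    qed
    finally have "4 * (X * w) \<le> 8 * k * G" by (simp add: algebra_simps)
    moreover have "4 * (X * w) = (1 - \<rho>) * (1 - 1 / c)" using w by (simp add: X_def)
    ultimately show ?thesis by (simp add: \<rho>_def)
  qed
qed

section \<open>Radial functions and angular sectors\<close>

lemma ex_polar_separating:
  fixes K :: "'a::euclidean_space set"
  assumes "convex K" "closed K" "0 \<in> K" "x \<notin> K"
  obtains n where "n \<in> polar K" "1 < n \<bullet> x"
proof -
  obtain a b where ab: "a \<bullet> x < b" "\<And>y. y \<in> K \<Longrightarrow> b < a \<bullet> y"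
    using separating_hyperplane_closed_point[OF assms(1,2,4)] by blast
  from ab(2)[OF assms(3)] have b: "b < 0" by simp
  show ?thesis
  proof
    show "(1 / b) *\<^sub>R a \<in> polar K"
      using ab(2) b by (force simp: polar_def divide_simps)
    show "1 < ((1 / b) *\<^sub>R a) \<bullet> x"
      using ab(1) b by (simp add: divide_simps)
  qed
qed

text \<open>\<open>R\<close> is the reciprocal of the support function of the polar body. That
  function is Lipschitz, being a maximum of forms of bounded norm; the bipolar theorem puts the
  scaled point into \<open>K\<close>, and a maximising form is a touching normal there.\<close>

lemma ex_radial_function:
  fixes K :: "'a::euclidean_space set"
  assumes K: "convex K" "compact K" "0 \<in> interior K"
  obtains R :: "'a \<Rightarrow> real" where "continuous_on (- {0}) R"
    and "\<And>d. d \<noteq> 0 \<Longrightarrow> 0 < R d"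
    and "\<And>d. d \<noteq> 0 \<Longrightarrow> R d *\<^sub>R d \<in> K"
    and "\<And>d. d \<noteq> 0 \<Longrightarrow> \<exists>n\<in>polar K. n \<bullet> (R d *\<^sub>R d) = 1"
proof -
  have 0: "0 \<in> K" using K interior_subset by blast
  have "\<exists>n\<in>polar K. \<forall>m\<in>polar K. m \<bullet> x \<le> n \<bullet> x" for x
    using compact_polar[OF K(3)] zero_in_polar
    by (intro continuous_attains_sup) (auto intro!: continuous_intros)
  then obtain N where N: "\<And>x. N x \<in> polar K" "\<And>x m. m \<in> polar K \<Longrightarrow> m \<bullet> x \<le> N x \<bullet> x"
    by metis
  define g where "g x = N x \<bullet> x" for x
  obtain B where B: "\<And>n. n \<in> polar K \<Longrightarrow> norm n \<le> B"
    using bounded_polar[OF K(3)] by (auto simp: bounded_iff)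
  obtain B' where B': "0 < B'" "\<And>x. x \<in> K \<Longrightarrow> norm x \<le> B'"
    using compact_imp_bounded[OF K(2)] by (auto simp: bounded_pos)
  have lip: "g x \<le> g y + B * norm (x - y)" for x y
  proof -
    have "g x = N x \<bullet> y + N x \<bullet> (x - y)" by (simp add: g_def inner_diff_right)
    also have "N x \<bullet> y \<le> g y" by (simp add: g_def N)
    also have "N x \<bullet> (x - y) \<le> norm (N x) * norm (x - y)" by (rule norm_cauchy_schwarz)
    also have "\<dots> \<le> B * norm (x - y)" by (intro mult_right_mono B N) auto
    finally show ?thesis by simp
  qed
  have "0 \<le> B" using B[OF zero_in_polar] by simp
  have contg: "continuous_on UNIV g"
  proof (rule lipschitz_on_continuous_on)
    show "B-lipschitz_on UNIV g"
    proof (rule lipschitz_onI)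
      fix x y show "dist (g x) (g y) \<le> B * dist x y"
        using lip[of x y] lip[of y x] by (simp add: dist_real_def dist_norm norm_minus_commute abs_le_iff)
    qed fact
  qed
  have gpos: "0 < g d" if "d \<noteq> 0" for d
  proof -
    have "(1 / (B' * norm d)) *\<^sub>R d \<in> polar K"
    proof (rule polar_scale_mem)
      fix x assume "x \<in> K"
      have "d \<bullet> x \<le> norm d * norm x" by (rule norm_cauchy_schwarz)
      also have "\<dots> \<le> norm d * B'" using B'(2)[OF \<open>x \<in> K\<close>] by (intro mult_left_mono) auto
      finally show "d \<bullet> x \<le> B' * norm d" by (simp add: mult.commute)
    qed (use B' that in auto)
    then have "((1 / (B' * norm d)) *\<^sub>R d) \<bullet> d \<le> g d" by (simp only: g_def N)
    moreover have "0 < ((1 / (B' * norm d)) *\<^sub>R d) \<bullet> d" using that B' by simp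
    ultimately show ?thesis by linarith
  qed
  show ?thesis
  proof
    show "continuous_on (- {0}) (\<lambda>d. 1 / g d)"
      using gpos by (intro continuous_intros continuous_on_subset[OF contg]) (auto simp: less_le)
    fix d :: 'a assume d: "d \<noteq> 0"
    show "0 < 1 / g d" using gpos[OF d] by simp
    have N1: "N d \<bullet> ((1 / g d) *\<^sub>R d) = 1" using gpos[OF d] by (simp add: g_def)
    then show "\<exists>n\<in>polar K. n \<bullet> ((1 / g d) *\<^sub>R d) = 1" using N by blast
    show "(1 / g d) *\<^sub>R d \<in> K"
    proof (rule ccontr)
      assume "(1 / g d) *\<^sub>R d \<notin> K"
      then obtain n where n: "n \<in> polar K" "1 < n \<bullet> ((1 / g d) *\<^sub>R d)"
        using ex_polar_separating[OF K(1) compact_imp_closed[OF K(2)] 0] by blast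
      then have "g d < n \<bullet> d" using gpos[OF d] by (simp add: field_simps)
      then show False using N(2)[OF n(1), of d] by (simp add: g_def)
    qed
  qed
qed

section \<open>Polar coordinates and the area of angular wedges\<close>

definition dir :: "real \<Rightarrow> real^2" where
  "dir \<theta> = vector [cos \<theta>, sin \<theta>]"

lemma dir_nth [simp]: "dir \<theta> $ 1 = cos \<theta>" "dir \<theta> $ 2 = sin \<theta>"
  by (simp_all add: dir_def)

lemma norm_dir [simp]: "norm (dir \<theta>) = 1"
  by (simp add: norm_eq_1 inner_real2 flip: power2_eq_square)

lemma dir_nz [simp]: "dir \<theta> \<noteq> 0"
  by (metis norm_dir norm_zero zero_neq_one)

lemma det2_dir: "det2 (dir \<alpha>) (dir \<beta>) = sin (\<beta> - \<alpha>)"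
  by (simp add: det2_def sin_diff)

lemma inner_dir: "dir \<alpha> \<bullet> dir \<beta> = cos (\<beta> - \<alpha>)"
  by (simp add: inner_real2 cos_diff)

lemma dir_periodic: "dir (\<theta> + 2 * pi) = dir \<theta>"
  by (simp add: real2_eq_iff)

lemma continuous_on_dir:
  fixes f :: "'a::t2_space \<Rightarrow> real"
  shows "continuous_on S f \<Longrightarrow> continuous_on S (\<lambda>x. dir (f x))"
proof -
  assume f: "continuous_on S f"
  have "dir \<theta> = cos \<theta> *\<^sub>R axis 1 1 + sin \<theta> *\<^sub>R axis 2 1" for \<theta>
    by (simp add: real2_eq_iff axis_def)
  then show ?thesis by (simp only:) (intro continuous_intros continuous_on_cos continuous_on_sin f)
qed

lemma ex_dir_from:
  fixes x :: "real^2"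
  obtains t where "0 \<le> t" "t < 2 * pi" "x = norm x *\<^sub>R dir (\<alpha> + t)"
proof (cases "x = 0")
  case True then show ?thesis using that[of 0] by simp
next
  case False
  define p q where "p = (dir \<alpha> \<bullet> x) / norm x" and "q = det2 (dir \<alpha>) x / norm x"
  have "(dir \<alpha> \<bullet> x)\<^sup>2 + (det2 (dir \<alpha>) x)\<^sup>2 = ((cos \<alpha>)\<^sup>2 + (sin \<alpha>)\<^sup>2) * ((x $ 1)\<^sup>2 + (x $ 2)\<^sup>2)"
    unfolding inner_real2 det2_def dir_nth by algebra
  also have "\<dots> = (norm x)\<^sup>2"
    by (simp add: power2_norm_eq_inner inner_real2 flip: power2_eq_square)
  finally have "p\<^sup>2 + q\<^sup>2 = 1"
    using False by (simp add: p_def q_def power_divide flip: add_divide_distrib)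
  then obtain t where t: "0 \<le> t" "t < 2 * pi" "p = cos t" "q = sin t"
    using sincos_total_2pi by metis
  have "dir \<alpha> \<bullet> x = norm x * cos t" "det2 (dir \<alpha>) x = norm x * sin t"
    using t False by (simp_all add: p_def q_def field_simps)
  then have 1: "cos \<alpha> * x $ 1 + sin \<alpha> * x $ 2 = norm x * cos t"
     "cos \<alpha> * x $ 2 - sin \<alpha> * x $ 1 = norm x * sin t"
    by (simp_all add: inner_real2 det2_def)
  have 2: "cos \<alpha> * cos \<alpha> + sin \<alpha> * sin \<alpha> = 1"
    using sin_cos_squared_add2[of \<alpha>] by (simp add: power2_eq_square)
  have "x $ 1 = norm x * (cos \<alpha> * cos t - sin \<alpha> * sin t)"
    "x $ 2 = norm x * (sin \<alpha> * cos t + cos \<alpha> * sin t)"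
    using 1 2 by algebra+
  then have "x = norm x *\<^sub>R dir (\<alpha> + t)"
    by (simp add: real2_eq_iff cos_add sin_add)
  then show ?thesis using t that by blast
qed

lemma cone2_scale:
  assumes "0 < s" "0 < t"
  shows "cone2 (s *\<^sub>R u) (t *\<^sub>R v) = cone2 u v"
proof
  show "cone2 (s *\<^sub>R u) (t *\<^sub>R v) \<subseteq> cone2 u v"
    using assms cone2I[of s 0 u v] cone2I[of 0 t u v] by (intro cone2_subset) auto
  show "cone2 u v \<subseteq> cone2 (s *\<^sub>R u) (t *\<^sub>R v)"
    using assms cone2I[of "1/s" 0 "s *\<^sub>R u" "t *\<^sub>R v"] cone2I[of 0 "1/t" "s *\<^sub>R u" "t *\<^sub>R v"]
    by (intro cone2_subset) auto
qed

text \<open>Bounding by real angles lets the sector open to a full turn, whereas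
  \<open>cone2\<close> describes it only below a half turn. This makes sector area a continuous
  function of the end angle all the way round.\<close>

definition wedge :: "real \<Rightarrow> real \<Rightarrow> (real^2) set" where
  "wedge \<alpha> \<beta> = {r *\<^sub>R dir \<theta> | r \<theta>. 0 \<le> r \<and> \<alpha> \<le> \<theta> \<and> \<theta> \<le> \<beta>}"

lemma wedgeI: "0 \<le> r \<Longrightarrow> \<alpha> \<le> \<theta> \<Longrightarrow> \<theta> \<le> \<beta> \<Longrightarrow> r *\<^sub>R dir \<theta> \<in> wedge \<alpha> \<beta>"
  by (auto simp: wedge_def)

lemma wedgeE:
  assumes "x \<in> wedge \<alpha> \<beta>"
  obtains \<theta> where "\<alpha> \<le> \<theta>" "\<theta> \<le> \<beta>" "x = norm x *\<^sub>R dir \<theta>"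
  using assms unfolding wedge_def by force

lemma wedge_mono: "\<beta> \<le> \<gamma> \<Longrightarrow> wedge \<alpha> \<beta> \<subseteq> wedge \<alpha> \<gamma>"
  by (force simp: wedge_def)

lemma wedge_full: "wedge \<alpha> (\<alpha> + 2 * pi) = UNIV"
proof -
  have "x \<in> wedge \<alpha> (\<alpha> + 2 * pi)" for x
  proof -
    obtain t where t: "0 \<le> t" "t < 2 * pi" "x = norm x *\<^sub>R dir (\<alpha> + t)" by (rule ex_dir_from)
    have "norm x *\<^sub>R dir (\<alpha> + t) \<in> wedge \<alpha> (\<alpha> + 2 * pi)"
      using t by (intro wedgeI) auto
    then show ?thesis using t by simp
  qed
  then show ?thesis by auto
qed

lemma wedge_eq_cone2:
  assumes "\<alpha> < \<beta>" "\<beta> < \<alpha> + pi"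
  shows "wedge \<alpha> \<beta> = cone2 (dir \<alpha>) (dir \<beta>)"
proof
  have s: "0 < sin (\<beta> - \<alpha>)" using assms by (intro sin_gt_zero) auto
  show "wedge \<alpha> \<beta> \<subseteq> cone2 (dir \<alpha>) (dir \<beta>)"
  proof
    fix x assume "x \<in> wedge \<alpha> \<beta>"
    then obtain \<theta> where \<theta>: "\<alpha> \<le> \<theta>" "\<theta> \<le> \<beta>" "x = norm x *\<^sub>R dir \<theta>" by (rule wedgeE)
    define r where "r = norm x"
    have "x = (det2 x (dir \<beta>) / sin (\<beta> - \<alpha>)) *\<^sub>R dir \<alpha> + (det2 (dir \<alpha>) x / sin (\<beta> - \<alpha>)) *\<^sub>R dir \<beta>"
      using det2_expand'[of "dir \<alpha>" "dir \<beta>" x] s by (simp add: det2_dir)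
    moreover have "det2 x (dir \<beta>) = r * sin (\<beta> - \<theta>)" "det2 (dir \<alpha>) x = r * sin (\<theta> - \<alpha>)"
      by (subst \<theta>(3), simp add: det2_linear det2_dir r_def)+
    moreover have "0 \<le> sin (\<beta> - \<theta>)" "0 \<le> sin (\<theta> - \<alpha>)"
      using \<theta> assms by (auto intro!: sin_ge_zero)
    ultimately show "x \<in> cone2 (dir \<alpha>) (dir \<beta>)"
      using s by (metis cone2I divide_nonneg_pos mult_nonneg_nonneg norm_ge_zero r_def)
  qed
  show "cone2 (dir \<alpha>) (dir \<beta>) \<subseteq> wedge \<alpha> \<beta>"
  proof
    fix x assume "x \<in> cone2 (dir \<alpha>) (dir \<beta>)"
    then obtain s t where st: "0 \<le> s" "0 \<le> t" "x = s *\<^sub>R dir \<alpha> + t *\<^sub>R dir \<beta>" by (rule cone2E)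
    obtain \<tau> where \<tau>: "0 \<le> \<tau>" "\<tau> < 2 * pi" "x = norm x *\<^sub>R dir (\<alpha> + \<tau>)" by (rule ex_dir_from)
    show "x \<in> wedge \<alpha> \<beta>"
    proof (cases "x = 0")
      case True then show ?thesis using wedgeI[of 0 \<alpha> \<alpha> \<beta>] assms by simp
    next
      case False
      then have r: "0 < norm x" by simp
      have "det2 (dir \<alpha>) x = norm x * sin \<tau>" by (subst \<tau>(3)) (simp add: det2_linear det2_dir)
      moreover have "det2 (dir \<alpha>) x = t * sin (\<beta> - \<alpha>)" by (simp add: st(3) det2_linear det2_dir)
      ultimately have "0 \<le> norm x * sin \<tau>" using st s by simp
      then have 1: "0 \<le> sin \<tau>" using r by (simp add: zero_le_mult_iff)
      have "det2 x (dir \<beta>) = norm x * sin (\<beta> - \<alpha> - \<tau>)"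
        by (subst \<tau>(3)) (simp add: det2_linear det2_dir diff_diff_eq)
      moreover have "det2 x (dir \<beta>) = s * sin (\<beta> - \<alpha>)" by (simp add: st(3) det2_linear det2_dir)
      ultimately have "0 \<le> norm x * sin (\<beta> - \<alpha> - \<tau>)" using st s by simp
      then have 2: "0 \<le> sin (\<beta> - \<alpha> - \<tau>)" using r by (simp add: zero_le_mult_iff)
      have "\<tau> \<le> pi"
        using 1 \<tau> sin_lt_zero[of \<tau>] by fastforce
      then have "\<tau> \<le> \<beta> - \<alpha>"
        using 2 assms sin_gt_zero[of "\<tau> - (\<beta> - \<alpha>)"] sin_minus[of "\<beta> - \<alpha> - \<tau>"] by fastforce
      then show ?thesis using \<tau> wedgeI[of "norm x" \<alpha> "\<alpha> + \<tau>" \<beta>] by simp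
    qed
  qed
qed

lemma compact_Int_wedge:
  assumes "compact K"
  shows "compact (K \<inter> wedge \<alpha> \<beta>)"
proof -
  obtain B where B: "\<And>x. x \<in> K \<Longrightarrow> norm x \<le> B"
    using compact_imp_bounded[OF assms] by (auto simp: bounded_iff)
  let ?I = "(\<lambda>(r, \<theta>). r *\<^sub>R dir \<theta>) ` ({0..B} \<times> {\<alpha>..\<beta>})"
  have "K \<inter> wedge \<alpha> \<beta> = K \<inter> ?I"
  proof (intro set_eqI iffI; elim IntE; intro IntI)
    fix x assume "x \<in> K" "x \<in> wedge \<alpha> \<beta>"
    moreover from this obtain \<theta> where "\<alpha> \<le> \<theta>" "\<theta> \<le> \<beta>" "x = norm x *\<^sub>R dir \<theta>" by (auto elim: wedgeE)
    ultimately show "x \<in> ?I"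
      using B by (intro image_eqI[of _ _ "(norm x, \<theta>)"]) auto
  qed (force simp: wedge_def)+
  moreover have "compact ?I"
    by (intro compact_continuous_image compact_Times)
      (auto simp: case_prod_unfold intro!: continuous_intros continuous_on_dir)
  ultimately show ?thesis using assms by (simp add: compact_Int)
qed

lemma wedge_area_mono:
  assumes "compact K" "\<beta> \<le> \<gamma>"
  shows "measure lebesgue (K \<inter> wedge \<alpha> \<beta>) \<le> measure lebesgue (K \<inter> wedge \<alpha> \<gamma>)"
  using assms wedge_mono[OF assms(2)]
  by (intro measure_mono_fmeasurable fmeasurableD lmeasurable_compact compact_Int_wedge) auto

lemma wedge_area_increase:
  assumes "convex K" "compact K" "\<alpha> \<le> \<beta>" "\<beta> < \<gamma>" "\<gamma> < \<beta> + pi" "\<gamma> \<le> \<alpha> + 2 * pi"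
  shows "measure lebesgue (K \<inter> wedge \<alpha> \<beta>) + sector_area K (dir \<beta>) (dir \<gamma>)
    \<le> measure lebesgue (K \<inter> wedge \<alpha> \<gamma>)"
proof -
  have bK: "bounded K" using assms compact_imp_bounded by blast
  have w: "wedge \<beta> \<gamma> = cone2 (dir \<beta>) (dir \<gamma>)" using assms by (intro wedge_eq_cone2) auto
  have "negligible ((K \<inter> wedge \<alpha> \<beta>) \<inter> (K \<inter> wedge \<beta> \<gamma>))"
  proof (rule negligible_subset)
    \<comment> \<open>The ray at \<open>\<alpha>\<close> is part of the overlap when
      \<open>\<gamma> = \<alpha> + 2 * pi\<close>.\<close>
    show "negligible ({x. det2 (dir \<beta>) x = 0} \<union> {x. det2 (dir \<alpha>) x = 0})"
      by (intro negligible_Un negligible_det2[OF dir_nz]) auto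
    show "K \<inter> wedge \<alpha> \<beta> \<inter> (K \<inter> wedge \<beta> \<gamma>) \<subseteq> {x. det2 (dir \<beta>) x = 0} \<union> {x. det2 (dir \<alpha>) x = 0}"
    proof
      fix x assume "x \<in> K \<inter> wedge \<alpha> \<beta> \<inter> (K \<inter> wedge \<beta> \<gamma>)"
      then obtain \<phi> \<psi> where \<phi>: "\<alpha> \<le> \<phi>" "\<phi> \<le> \<beta>" "x = norm x *\<^sub>R dir \<phi>"
        and \<psi>: "\<beta> \<le> \<psi>" "\<psi> \<le> \<gamma>" "x = norm x *\<^sub>R dir \<psi>"
        by (auto elim!: wedgeE)
      show "x \<in> {x. det2 (dir \<beta>) x = 0} \<union> {x. det2 (dir \<alpha>) x = 0}"
      proof (cases "x = 0")
        case False
        then have "dir \<phi> = dir \<psi>"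
          using \<phi>(3) \<psi>(3) by (metis norm_eq_zero scaleR_left_imp_eq)
        then have "cos (\<psi> - \<phi>) = 1" using inner_dir[of \<phi> \<psi>] inner_dir[of \<psi> \<psi>] by simp
        moreover have "0 \<le> \<psi> - \<phi>" "\<psi> - \<phi> \<le> 2 * pi" using \<phi> \<psi> assms by auto
        moreover have "x = 0 \<or> x = 2 * pi" if "cos x = 1" "0 \<le> x" "x \<le> 2 * pi" for x :: real
        proof -
          obtain n :: int where n: "x = real_of_int n * 2 * pi" using \<open>cos x = 1\<close> cos_one_2pi_int by blast
          with that have "0 \<le> n" "n \<le> 1" using pi_gt_zero by (auto simp: zero_le_mult_iff)
          then have "n = 0 \<or> n = 1" by linarith
          then show ?thesis using n by auto
        qed
        ultimately consider "\<psi> = \<phi>" | "\<psi> - \<phi> = 2 * pi"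
          using that by fastforce
        then show ?thesis
        proof cases
          case 1
          then have "\<phi> = \<beta>" using \<phi> \<psi> by simp
          then have "det2 (dir \<beta>) x = 0" by (subst \<phi>(3)) (simp add: det2_linear)
          then show ?thesis by simp
        next
          case 2
          then have "\<phi> = \<alpha>" using \<phi> \<psi> assms by simp
          then have "det2 (dir \<alpha>) x = 0" by (subst \<phi>(3)) (simp add: det2_linear)
          then show ?thesis by simp
        qed
      qed simp
    qed
  qed
  then have "measure lebesgue (K \<inter> wedge \<alpha> \<beta>) + measure lebesgue (K \<inter> wedge \<beta> \<gamma>)
      = measure lebesgue ((K \<inter> wedge \<alpha> \<beta>) \<union> (K \<inter> wedge \<beta> \<gamma>))"
    using assms by (intro measure_Un_negligible_Int lmeasurable_compact compact_Int_wedge) auto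
  also have "\<dots> \<le> measure lebesgue (K \<inter> wedge \<alpha> \<gamma>)"
  proof (rule measure_mono_fmeasurable)
    show "K \<inter> wedge \<alpha> \<beta> \<union> K \<inter> wedge \<beta> \<gamma> \<subseteq> K \<inter> wedge \<alpha> \<gamma>"
      using assms by (force simp: wedge_def)
  qed (use assms in \<open>auto intro!: fmeasurableD lmeasurable_compact compact_Int_wedge\<close>)
  finally show ?thesis by (simp add: sector_area_def w)
qed

lemma wedge_area_lipschitz:
  assumes "compact K" "\<And>x. x \<in> K \<Longrightarrow> norm x \<le> B" "\<beta> < \<gamma>" "\<gamma> \<le> \<beta> + pi / 2"
  shows "measure lebesgue (K \<inter> wedge \<alpha> \<gamma>)
    \<le> measure lebesgue (K \<inter> wedge \<alpha> \<beta>) + 2 * B\<^sup>2 * (\<gamma> - \<beta>)"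
proof -
  have w: "wedge \<beta> \<gamma> = cone2 (dir \<beta>) (dir \<gamma>)" using assms by (intro wedge_eq_cone2) auto
  \<comment> \<open>Within a quarter turn the cosine is nonnegative, so both coordinates
    \<open>s\<close>, \<open>t\<close> of a point of norm at most \<open>B\<close> are at most
    \<open>B\<close>; vertices at distance \<open>2 * B\<close> make
    \<open>s / (2 * B) + t / (2 * B) \<le> 1\<close>.\<close>
  let ?T = "convex hull {0, (2 * B) *\<^sub>R dir \<beta>, (2 * B) *\<^sub>R dir \<gamma>}"
  have "K \<inter> wedge \<beta> \<gamma> \<subseteq> ?T"
  proof
    fix x assume x: "x \<in> K \<inter> wedge \<beta> \<gamma>"
    then obtain s t where st: "0 \<le> s" "0 \<le> t" "x = s *\<^sub>R dir \<beta> + t *\<^sub>R dir \<gamma>"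
      unfolding w by (auto elim: cone2E)
    have "0 \<le> cos (\<gamma> - \<beta>)" using assms by (intro cos_ge_zero) auto
    have xB: "norm x \<le> B" using x assms by auto
    have "x \<bullet> dir \<beta> = s + t * cos (\<gamma> - \<beta>)" "x \<bullet> dir \<gamma> = s * cos (\<gamma> - \<beta>) + t"
      by (simp_all add: st inner_add_left inner_dir cos_minus[of "\<gamma> - \<beta>", simplified])
    moreover have "x \<bullet> dir \<beta> \<le> B" "x \<bullet> dir \<gamma> \<le> B"
      using norm_cauchy_schwarz[of x "dir \<beta>"] norm_cauchy_schwarz[of x "dir \<gamma>"] xB by simp_all
    ultimately have "s \<le> B" "t \<le> B"
      using st \<open>0 \<le> cos (\<gamma> - \<beta>)\<close> by (smt (verit) mult_nonneg_nonneg)+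
    show "x \<in> ?T"
    proof (cases "B = 0")
      case True
      then have "x = 0" using xB by simp
      then show ?thesis by (simp add: hull_inc)
    next
      case False
      then have "0 < B" using xB by (metis norm_ge_zero order_trans less_le)
      then have "x = (1 - s / (2 * B) - t / (2 * B)) *\<^sub>R 0 + (s / (2 * B)) *\<^sub>R ((2 * B) *\<^sub>R dir \<beta>) + (t / (2 * B)) *\<^sub>R ((2 * B) *\<^sub>R dir \<gamma>)"
        by (simp add: st)
      moreover have "0 \<le> 1 - s / (2 * B) - t / (2 * B)" "0 \<le> s / (2 * B)" "0 \<le> t / (2 * B)"
      proof -
        have "s / (2 * B) \<le> 1 / 2" "t / (2 * B) \<le> 1 / 2"
          using \<open>0 < B\<close> \<open>s \<le> B\<close> \<open>t \<le> B\<close> by (auto simp: field_simps)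
        then show "0 \<le> 1 - s / (2 * B) - t / (2 * B)" by linarith
      qed (use \<open>0 < B\<close> st in auto)
      ultimately show ?thesis
        unfolding convex_hull_3 by (smt (verit, best) mem_Collect_eq)
    qed
  qed
  then have "measure lebesgue (K \<inter> wedge \<beta> \<gamma>) \<le> measure lebesgue ?T"
    using assms by (intro measure_mono_fmeasurable fmeasurableD lmeasurable_compact compact_Int_wedge compact_convex_hull) auto
  also have "\<dots> = measure lborel ?T"
    by (intro measure_completion) (auto intro!: borel_compact compact_convex_hull)
  also have "\<dots> = \<bar>(2 * B) * (2 * B) * det2 (dir \<beta>) (dir \<gamma>)\<bar> / 2"
    by (subst content_triangle) (simp add: det2_def algebra_simps)
  also have "\<dots> = 2 * B\<^sup>2 * \<bar>sin (\<gamma> - \<beta>)\<bar>" 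
    unfolding det2_dir by (simp add: abs_mult power2_eq_square)
  also have "\<dots> \<le> 2 * B\<^sup>2 * (\<gamma> - \<beta>)"
    using abs_sin_x_le_abs_x[of "\<gamma> - \<beta>"] assms by (intro mult_left_mono) auto
  finally have 1: "measure lebesgue (K \<inter> wedge \<beta> \<gamma>) \<le> 2 * B\<^sup>2 * (\<gamma> - \<beta>)" .
  have "measure lebesgue (K \<inter> wedge \<alpha> \<gamma>) \<le> measure lebesgue ((K \<inter> wedge \<alpha> \<beta>) \<union> (K \<inter> wedge \<beta> \<gamma>))"
  proof (rule measure_mono_fmeasurable)
    show "K \<inter> wedge \<alpha> \<gamma> \<subseteq> K \<inter> wedge \<alpha> \<beta> \<union> K \<inter> wedge \<beta> \<gamma>"
      by (auto simp: wedge_def) (metis linear)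
  qed (use assms in \<open>auto intro!: fmeasurableD fmeasurable.Un lmeasurable_compact compact_Int_wedge\<close>)
  also have "\<dots> \<le> measure lebesgue (K \<inter> wedge \<alpha> \<beta>) + measure lebesgue (K \<inter> wedge \<beta> \<gamma>)"
    using assms by (intro measure_Un_le fmeasurableD lmeasurable_compact compact_Int_wedge) auto
  finally show ?thesis using 1 by simp
qed

lemma continuous_on_wedge_area:
  assumes "compact K"
  shows "continuous_on UNIV (\<lambda>\<theta>. measure lebesgue (K \<inter> wedge \<alpha> \<theta>))"
proof -
  define H where "H \<theta> = measure lebesgue (K \<inter> wedge \<alpha> \<theta>)" for \<theta>
  obtain B where B: "\<And>x. x \<in> K \<Longrightarrow> norm x \<le> B"
    using compact_imp_bounded[OF assms] by (auto simp: bounded_iff)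
  define L where "L = 2 * B\<^sup>2"
  have le: "\<bar>H \<beta> - H \<gamma>\<bar> \<le> L * \<bar>\<beta> - \<gamma>\<bar>" if "\<bar>\<beta> - \<gamma>\<bar> \<le> pi / 2" for \<beta> \<gamma>
    using wedge_area_lipschitz[OF assms B, of \<beta> \<gamma> \<alpha>] wedge_area_lipschitz[OF assms B, of \<gamma> \<beta> \<alpha>]
      wedge_area_mono[OF assms, of \<beta> \<gamma> \<alpha>] wedge_area_mono[OF assms, of \<gamma> \<beta> \<alpha>] that
    unfolding H_def[symmetric] L_def[symmetric] by (cases "\<beta> = \<gamma>") (auto simp: abs_if split: if_splits)
  have "continuous_on UNIV H"
    unfolding continuous_on_iff
  proof (intro ballI allI impI)
    fix \<beta> e :: real assume "0 < e"
    have "0 \<le> L" by (simp add: L_def)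
    show "\<exists>d>0. \<forall>x'\<in>UNIV. dist x' \<beta> < d \<longrightarrow> dist (H x') (H \<beta>) < e"
    proof (intro exI conjI ballI impI)
      show "0 < min (pi / 2) (e / (L + 1))" using \<open>0 < e\<close> \<open>0 \<le> L\<close> by simp
      fix \<gamma> assume "dist \<gamma> \<beta> < min (pi / 2) (e / (L + 1))"
      then have d: "\<bar>\<gamma> - \<beta>\<bar> < pi / 2" "\<bar>\<gamma> - \<beta>\<bar> < e / (L + 1)" by (auto simp: dist_real_def)
      have "\<bar>H \<gamma> - H \<beta>\<bar> \<le> L * \<bar>\<gamma> - \<beta>\<bar>" using d by (intro le) auto
      also have "\<dots> \<le> (L + 1) * \<bar>\<gamma> - \<beta>\<bar>" by (intro mult_right_mono) auto
      also have "\<dots> < e" using d \<open>0 \<le> L\<close> by (simp add: field_simps)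
      finally show "dist (H \<gamma>) (H \<beta>) < e" by (simp add: dist_real_def)
    qed
  qed
  then show ?thesis by (simp add: H_def)
qed

section \<open>Balanced triangles\<close>

definition to_complex :: "real^2 \<Rightarrow> complex" where
  "to_complex x = Complex (x $ 1) (x $ 2)"

lemma to_complex_eq_0_iff [simp]: "to_complex x = 0 \<longleftrightarrow> x = 0"
  by (simp add: to_complex_def complex_eq_iff real2_eq_iff)

lemma continuous_on_to_complex: "continuous_on S f \<Longrightarrow> continuous_on S (\<lambda>x. to_complex (f x))"
  by (auto simp: to_complex_def Complex_eq intro!: continuous_intros)

lemma to_complex_scaleR_dir: "to_complex (r *\<^sub>R dir \<theta>) = of_real r * cis \<theta>"
  by (simp add: to_complex_def complex_eq_iff)

text \<open>The radius is deformed linearly to 1 and the initial angle to 0; the radius stays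
  positive, so the homotopy from the unit circle avoids the origin.\<close>

lemma winding_number_star_curve:
  assumes f: "continuous_on {0..1} f" "\<And>s. s \<in> {0..1} \<Longrightarrow> 0 < f s" "f 0 = f 1"
  shows "winding_number (\<lambda>s. of_real (f s) * cis (\<theta> + 2 * pi * s)) 0 = 1"
proof -
  have "homotopic_loops (- {0}) (circlepath 0 1) (\<lambda>s. of_real (f s) * cis (\<theta> + 2 * pi * s))"
    unfolding homotopic_loops
  proof (intro exI conjI)
    let ?h = "\<lambda>(r, s). of_real ((1 - r) + r * f s) * cis (r * \<theta> + 2 * pi * s)"
    have "continuous_on ({0..1::real} \<times> {0..1}) (\<lambda>x. f (snd x))"
      by (rule continuous_on_compose2[OF f(1)]) (auto intro!: continuous_intros)
    then show "continuous_on ({0..1::real} \<times> {0..1}) ?h"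
      by (auto simp: case_prod_unfold cis_conv_exp intro!: continuous_intros)
    have "0 < (1 - r) + r * f s" if "r \<in> {0..1}" "s \<in> {0..1}" for r s
    proof (cases "r = 0")
      case False
      then have "0 < r * f s" using that f(2) by simp
      then show ?thesis using that by simp
    qed simp
    then show "?h \<in> ({0..1} \<times> {0..1}) \<rightarrow> - {0}"
      by (auto simp del: of_real_add of_real_mult of_real_diff) (metis less_irrefl)
    show "\<forall>x\<in>{0..1}. ?h (0, x) = circlepath 0 1 x"
      by (auto simp: circlepath cis_conv_exp mult_ac)
    show "\<forall>t\<in>{0..1}. pathfinish (?h \<circ> Pair t) = pathstart (?h \<circ> Pair t)"
      using f(3) by (auto simp: pathfinish_def pathstart_def cis_mult[symmetric])
  qed auto
  then have "winding_number (circlepath 0 1) 0 = winding_number (\<lambda>s. of_real (f s) * cis (\<theta> + 2 * pi * s)) 0"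
    by (rule winding_number_homotopic_loops)
  then show ?thesis by (simp add: winding_number_circlepath_centre)
qed

text \<open>
  The sector of \<open>K\<close> over each side of the triangle has area \<open>c\<close> times that of the triangle spanned by
  that side and the origin.
\<close>

definition balanced_triangle ::
  "(real^2) set \<Rightarrow> real^2 \<Rightarrow> real^2 \<Rightarrow> real^2 \<Rightarrow> real \<Rightarrow> bool" where
  "balanced_triangle K A B C c \<longleftrightarrow>
     {A, B, C} \<subseteq> K \<and> (\<forall>P\<in>{A, B, C}. \<exists>n\<in>polar K. n \<bullet> P = 1) \<and>
     0 < det2 A B \<and> 0 < det2 B C \<and> 0 < det2 C A \<and> 0 < c \<and>
     sector_area K A B \<le> c * det2 A B / 2 \<and>
     sector_area K B C \<le> c * det2 B C / 2 \<and>
     sector_area K C A \<le> c * det2 C A / 2 \<and>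
     measure lebesgue K = c * (det2 A B + det2 B C + det2 C A) / 2"

text \<open>
  For boundary points \<open>A, B, C\<close> cutting \<open>K\<close> into sectors of area \<open>k1, k2, k3\<close> (opposite to \<open>A, B, C\<close>),
  being balanced means \<open>k1 A + k2 B + k3 C = 0\<close>. With \<open>A\<close> fixed, let \<open>F\<close> be the left-hand side as a
  function of the angles \<open>\<alpha> \<le> \<beta>\<close> of \<open>B\<close> and \<open>C\<close>. It is constant on two sides of the triangle of
  admissible \<open>(\<alpha>, \<beta>)\<close> and runs once around the boundary of \<open>K\<close> (scaled by its area) on the side
  \<open>\<alpha> = \<beta>\<close>, so it has a zero.
\<close>

lemma ex_balanced_triangle:
  fixes K :: "(real^2) set"
  assumes K: "convex K" "compact K" "0 \<in> interior K" and d: "d \<noteq> 0"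
  obtains A B C c s where "balanced_triangle K A B C c" "0 < s" "A = s *\<^sub>R d"
proof -
  obtain \<theta>0 where \<theta>0: "d = norm d *\<^sub>R dir \<theta>0"
    using ex_dir_from[of d 0] by auto
  have bK: "bounded K" using K compact_imp_bounded by blast
  have 0: "0 \<in> K" using K interior_subset by blast
  obtain R where R: "continuous_on (- {0}) R" "\<And>d. d \<noteq> 0 \<Longrightarrow> 0 < R d"
    "\<And>d. d \<noteq> 0 \<Longrightarrow> R d *\<^sub>R d \<in> K" "\<And>d. d \<noteq> 0 \<Longrightarrow> \<exists>n\<in>polar K. n \<bullet> (R d *\<^sub>R d) = 1"
    using ex_radial_function[OF K] by blast
  define \<rho> where "\<rho> \<theta> = R (dir (\<theta>0 + \<theta>))" for \<theta>
  define P where "P \<theta> = \<rho> \<theta> *\<^sub>R dir (\<theta>0 + \<theta>)" for \<theta>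
  define H where "H \<theta> = measure lebesgue (K \<inter> wedge \<theta>0 (\<theta>0 + \<theta>))" for \<theta>
  define F where "F \<alpha> \<beta> = (H \<beta> - H \<alpha>) *\<^sub>R P 0 + (H (2 * pi) - H \<beta>) *\<^sub>R P \<alpha> + H \<alpha> *\<^sub>R P \<beta>" for \<alpha> \<beta>
  have \<rho>pos: "0 < \<rho> \<theta>" for \<theta> by (simp add: \<rho>_def R)
  have P: "P \<theta> \<in> K" "\<exists>n\<in>polar K. n \<bullet> P \<theta> = 1" for \<theta> unfolding P_def \<rho>_def by (intro R dir_nz)+
  have Pnz: "P \<theta> \<noteq> 0" for \<theta> using \<rho>pos[of \<theta>] by (simp add: P_def)
  have detP: "det2 (P \<alpha>) (P \<beta>) = \<rho> \<alpha> * \<rho> \<beta> * sin (\<beta> - \<alpha>)" for \<alpha> \<beta>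
    by (simp add: P_def det2_linear det2_dir)
  have detP_pos: "0 < det2 (P \<alpha>) (P \<beta>) \<longleftrightarrow> 0 < sin (\<beta> - \<alpha>)" for \<alpha> \<beta>
    using mult_pos_pos[OF \<rho>pos[of \<alpha>] \<rho>pos[of \<beta>]] by (simp add: detP zero_less_mult_iff[of "\<rho> \<alpha> * \<rho> \<beta>"])
  have per: "\<rho> (2 * pi) = \<rho> 0" "P (2 * pi) = P 0"
    by (simp_all add: P_def \<rho>_def dir_periodic)
  have cont\<rho>: "continuous_on UNIV \<rho>"
    unfolding \<rho>_def by (rule continuous_on_compose2[OF R(1)])
      (auto intro!: continuous_on_dir continuous_intros)
  have contP: "continuous_on UNIV P"
    unfolding P_def using cont\<rho> by (intro continuous_intros continuous_on_dir) auto
  have contH: "continuous_on UNIV H"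
    unfolding H_def
    by (rule continuous_on_compose2[OF continuous_on_wedge_area[OF K(2)]]) (auto intro!: continuous_intros)
  have H2pi: "H (2 * pi) = measure lebesgue K"
    by (simp add: H_def wedge_full)
  have inc: "H \<beta> + sector_area K (P \<beta>) (P \<gamma>) \<le> H \<gamma>"
    if "0 \<le> \<beta>" "\<beta> < \<gamma>" "\<gamma> < \<beta> + pi" "\<gamma> \<le> 2 * pi" for \<beta> \<gamma>
    using wedge_area_increase[OF K(1,2), of \<theta>0 "\<theta>0 + \<beta>" "\<theta>0 + \<gamma>"] that
    by (simp add: H_def P_def sector_area_def cone2_scale[OF \<rho>pos \<rho>pos])
  have mono: "H \<beta> \<le> H \<gamma>" if "\<beta> \<le> \<gamma>" for \<beta> \<gamma>
    using that by (simp add: H_def wedge_area_mono[OF K(2)])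
  have strict: "H \<beta> < H \<gamma>" if "0 \<le> \<beta>" "\<beta> < \<gamma>" "\<gamma> \<le> 2 * pi" for \<beta> \<gamma>
  proof -
    define \<gamma>' where "\<gamma>' = min \<gamma> (\<beta> + pi / 2)"
    have \<gamma>': "\<beta> < \<gamma>'" "\<gamma>' < \<beta> + pi" "\<gamma>' \<le> \<gamma>" using that by (auto simp: \<gamma>'_def min_def)
    have "0 < sin (\<gamma>' - \<beta>)" using \<gamma>' by (intro sin_gt_zero) auto
    then have "0 < det2 (P \<beta>) (P \<gamma>')" by (simp add: detP_pos)
    moreover have "\<bar>det2 (P \<beta>) (P \<gamma>')\<bar> / 2 \<le> sector_area K (P \<beta>) (P \<gamma>')"
      using sector_area_ge_triangle[OF K(1) bK 0, of 1 "P \<beta>" 1 "P \<gamma>'"] P by simp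
    ultimately have "0 < sector_area K (P \<beta>) (P \<gamma>')" by linarith
    then show ?thesis using inc[of \<beta> \<gamma>'] mono[of \<gamma>' \<gamma>] \<gamma>' that by auto
  qed
  have H0: "H 0 = 0"
  proof -
    have "negligible (K \<inter> wedge \<theta>0 \<theta>0)"
    proof (rule negligible_det2[OF dir_nz[of \<theta>0]])
      fix x assume "x \<in> K \<inter> wedge \<theta>0 \<theta>0"
      then obtain \<theta> where \<theta>: "\<theta>0 \<le> \<theta>" "\<theta> \<le> \<theta>0" "x = norm x *\<^sub>R dir \<theta>" by (auto elim: wedgeE)
      then show "det2 (dir \<theta>0) x = 0"
        by (metis antisym det2_scaleR(2) det2_self mult_zero_right)
    qed
    then show ?thesis by (simp add: H_def negligible_imp_measure0)
  qed
  have Hpos: "0 < H (2 * pi)" using strict[of 0 "2 * pi"] H0 by simp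
  have F_0_left: "F 0 \<beta> = H (2 * pi) *\<^sub>R P 0" and F_2pi_right: "F \<alpha> (2 * pi) = H (2 * pi) *\<^sub>R P 0"
    and F_diag: "F \<alpha> \<alpha> = H (2 * pi) *\<^sub>R P \<alpha>" for \<alpha> \<beta>
    by (simp_all add: F_def H0 per flip: scaleR_add_left)
  have "\<exists>\<alpha> \<beta>. 0 \<le> \<alpha> \<and> \<alpha> \<le> \<beta> \<and> \<beta> \<le> 2 * pi \<and> F \<alpha> \<beta> = 0"
  proof (rule ccontr)
    assume "\<not> ?thesis"
    then have nz: "F \<alpha> \<beta> \<noteq> 0" if "0 \<le> \<alpha>" "\<alpha> \<le> \<beta>" "\<beta> \<le> 2 * pi" for \<alpha> \<beta>
      using that by blast
    let ?p = "\<lambda>s. of_real (H (2 * pi) * \<rho> (2 * pi * s)) * cis (\<theta>0 + 2 * pi * s)"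
    let ?q = "\<lambda>s::real. to_complex (H (2 * pi) *\<^sub>R P 0)"
    have "homotopic_loops (- {0}) ?p ?q"
      unfolding homotopic_loops
    proof (intro exI conjI)
      \<comment> \<open>For \<open>r = 0\<close> this runs along the diagonal, for
        \<open>r = 1\<close> it rests at \<open>(0, 2 * pi)\<close>. The ends \<open>s = 0\<close>
        and \<open>s = 1\<close> stay on the sides \<open>\<alpha> = 0\<close> and
        \<open>\<beta> = 2 * pi\<close>, where \<open>F\<close> has the same constant value, so
        every stage is a closed loop.\<close>
      let ?\<alpha> = "\<lambda>(r, s). 2 * pi * ((1 - r) * s)"
      let ?\<beta> = "\<lambda>(r, s). 2 * pi * ((1 - r) * s + r)"
      let ?h = "\<lambda>x. to_complex (F (?\<alpha> x) (?\<beta> x))"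
      have ab: "continuous_on ({0..1::real} \<times> {0..1}) ?\<alpha>" "continuous_on ({0..1::real} \<times> {0..1}) ?\<beta>"
        by (auto simp: case_prod_unfold intro!: continuous_intros)
      show "continuous_on ({0..1::real} \<times> {0..1}) ?h"
        unfolding F_def
        by (intro continuous_on_to_complex continuous_intros ab
            continuous_on_compose2[OF contP] continuous_on_compose2[OF contH]) auto
      have "0 \<le> 2 * pi * ((1 - r) * s)" "2 * pi * ((1 - r) * s) \<le> 2 * pi * ((1 - r) * s + r)"
          "2 * pi * ((1 - r) * s + r) \<le> 2 * pi" if "0 \<le> r" "r \<le> 1" "0 \<le> s" "s \<le> 1" for r s :: real
      proof -
        have "(1 - r) * s \<le> (1 - r) * 1" using that by (intro mult_left_mono) auto
        then show "2 * pi * ((1 - r) * s + r) \<le> 2 * pi" by simp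
      qed (use that in auto)
      then show "?h \<in> ({0..1} \<times> {0..1}) \<rightarrow> - {0}"
        using nz by auto
      show "\<forall>x\<in>{0..1}. ?h (0, x) = ?p x"
      proof
        fix x :: real
        have "F a a = (H (2 * pi) * \<rho> a) *\<^sub>R dir (\<theta>0 + a)" for a
          by (simp add: F_diag P_def)
        then have "to_complex (F (2 * pi * x) (2 * pi * x)) = ?p x"
          by (simp only: to_complex_scaleR_dir)
        then show "?h (0, x) = ?p x" by simp
      qed
      show "\<forall>x\<in>{0..1}. ?h (1, x) = ?q x"
        by (simp add: F_0_left)
      show "\<forall>t\<in>{0..1}. pathfinish (?h \<circ> Pair t) = pathstart (?h \<circ> Pair t)"
        by (simp add: pathfinish_def pathstart_def F_0_left F_2pi_right)
    qed
    then have "winding_number ?p 0 = winding_number ?q 0"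
      by (rule winding_number_homotopic_loops)
    moreover have "winding_number ?q 0 = 0"
      using Hpos Pnz by (intro winding_number_zero_const) simp
    moreover have "winding_number ?p 0 = 1"
    proof (rule winding_number_star_curve)
      show "continuous_on {0..1} (\<lambda>s. H (2 * pi) * \<rho> (2 * pi * s))"
        by (intro continuous_intros continuous_on_compose2[OF cont\<rho>]) auto
    qed (use Hpos \<rho>pos per in auto)
    ultimately show False by simp
  qed
  then obtain \<alpha> \<beta> where ab: "0 \<le> \<alpha>" "\<alpha> \<le> \<beta>" "\<beta> \<le> 2 * pi" and F0: "F \<alpha> \<beta> = 0" by blast
  have "\<alpha> \<noteq> 0" "\<alpha> \<noteq> \<beta>" "\<beta> \<noteq> 2 * pi"
    using F0 Hpos Pnz F_0_left F_diag F_2pi_right by auto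
  then have ab': "0 < \<alpha>" "\<alpha> < \<beta>" "\<beta> < 2 * pi" using ab by auto
  define k1 k2 k3 where "k1 = H \<beta> - H \<alpha>" and "k2 = H (2 * pi) - H \<beta>" and "k3 = H \<alpha>"
  have k: "0 < k1" "0 < k2" "0 < k3"
    using strict[of \<alpha> \<beta>] strict[of \<beta> "2 * pi"] strict[of 0 \<alpha>] ab' H0 by (auto simp: k1_def k2_def k3_def)
  have bal: "k1 *\<^sub>R P 0 + k2 *\<^sub>R P \<alpha> + k3 *\<^sub>R P \<beta> = 0"
    using F0 by (simp add: F_def k1_def k2_def k3_def)
  have "det2 (P 0) (k1 *\<^sub>R P 0 + k2 *\<^sub>R P \<alpha> + k3 *\<^sub>R P \<beta>) = 0"
    "det2 (P \<alpha>) (k1 *\<^sub>R P 0 + k2 *\<^sub>R P \<alpha> + k3 *\<^sub>R P \<beta>) = 0"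
    by (simp_all add: bal)
  then have e: "k2 * det2 (P 0) (P \<alpha>) = k3 * det2 (P \<beta>) (P 0)" "k1 * det2 (P 0) (P \<alpha>) = k3 * det2 (P \<alpha>) (P \<beta>)"
    by (simp_all add: det2_linear det2_commute[of "P 0" "P \<beta>"] det2_commute[of "P \<alpha>" "P 0"])
  \<comment> \<open>If \<open>\<alpha>\<close> were at least \<open>pi\<close>, then
    \<open>\<beta>\<close> would lie strictly between \<open>pi\<close> and \<open>2 * pi\<close>,
    making the right-hand side of the first relation in \<open>e\<close> positive and its left-hand
    side nonpositive.\<close>
  have D1: "0 < det2 (P 0) (P \<alpha>)"
  proof (rule ccontr)
    assume D: "\<not> 0 < det2 (P 0) (P \<alpha>)"
    then have "pi \<le> \<alpha>" using sin_gt_zero[of \<alpha>] ab' by (fastforce simp: detP_pos)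
    then have "sin \<beta> < 0" using sin_lt_zero[of \<beta>] ab' by auto
    then have "0 < det2 (P \<beta>) (P 0)" by (simp add: detP_pos)
    then have "0 < k2 * det2 (P 0) (P \<alpha>)" using e(1) k by simp
    then show False using D k by (simp add: zero_less_mult_iff)
  qed
  have D2: "0 < det2 (P \<alpha>) (P \<beta>)" "0 < det2 (P \<beta>) (P 0)"
    using e k D1 by (metis mult_pos_pos zero_less_mult_pos)+
  have sin: "0 < sin \<alpha>" "0 < sin (\<beta> - \<alpha>)" "0 < sin (- \<beta>)"
    using D1 D2 by (simp_all add: detP_pos)
  have ang: "\<alpha> < pi" "\<beta> - \<alpha> < pi" "pi < \<beta>"
    using sin sin_le_zero[of \<alpha>] sin_le_zero[of "\<beta> - \<alpha>"] sin_ge_zero[of \<beta>] ab' by fastforce+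
  \<comment> \<open>The relations \<open>e\<close> say that sector area and triangle area have the
    same ratio over all three sides.\<close>
  define c where "c = 2 * k3 / det2 (P 0) (P \<alpha>)"
  have c: "0 < c" using k D1 by (simp add: c_def)
  have kc: "k3 = c * det2 (P 0) (P \<alpha>) / 2" "k1 = c * det2 (P \<alpha>) (P \<beta>) / 2" "k2 = c * det2 (P \<beta>) (P 0) / 2"
    using e D1 by (simp_all add: c_def field_simps)
  have "balanced_triangle K (P 0) (P \<alpha>) (P \<beta>) c"
    unfolding balanced_triangle_def
  proof (intro conjI)
    show "sector_area K (P 0) (P \<alpha>) \<le> c * det2 (P 0) (P \<alpha>) / 2"
      using inc[of 0 \<alpha>] ab' ang H0 by (simp flip: kc add: k3_def)
    show "sector_area K (P \<alpha>) (P \<beta>) \<le> c * det2 (P \<alpha>) (P \<beta>) / 2"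
      using inc[of \<alpha> \<beta>] ab' ang by (simp flip: kc add: k1_def)
    show "sector_area K (P \<beta>) (P 0) \<le> c * det2 (P \<beta>) (P 0) / 2"
      using inc[of \<beta> "2 * pi"] ab' ang by (simp flip: kc add: k2_def per)
    have "c * (det2 (P 0) (P \<alpha>) + det2 (P \<alpha>) (P \<beta>) + det2 (P \<beta>) (P 0)) / 2 = k3 + k1 + k2"
      using kc by (simp add: field_simps)
    then show "measure lebesgue K = c * (det2 (P 0) (P \<alpha>) + det2 (P \<alpha>) (P \<beta>) + det2 (P \<beta>) (P 0)) / 2"
      by (simp add: k1_def k2_def k3_def H2pi)
  qed (use P D1 D2 c in auto)
  moreover have "(\<rho> 0 / norm d) *\<^sub>R (norm d *\<^sub>R dir \<theta>0) = P 0"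
    using d by (simp add: P_def)
  then have "P 0 = (\<rho> 0 / norm d) *\<^sub>R d" using \<theta>0 by simp
  ultimately show ?thesis using that \<rho>pos[of 0] d by (metis divide_pos_pos zero_less_norm_iff)
qed

section \<open>The hexagon in the polar body and the excess over it\<close>

lemma polarD: "n \<in> polar K \<Longrightarrow> x \<in> K \<Longrightarrow> n \<bullet> x \<le> 1"
  by (simp add: polar_def)

text \<open>A maximiser of \<open>a\<close> may fall outside the cone over \<open>AB\<close>, but
  there the support lines at \<open>A\<close> and \<open>B\<close> force
  \<open>a \<bullet> q0 \<le> 1\<close>, so \<open>A\<close> is a maximiser too. The bound by
  \<open>c\<close> compares the quadrilateral \<open>OAqB\<close> with the sector.\<close>

lemma ex_sector_maximum:
  fixes K :: "(real^2) set"
  assumes K: "convex K" "compact K" "0 \<in> interior K"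
    and A: "A \<in> K" "As \<in> polar K" "As \<bullet> A = 1"
    and B: "B \<in> K" "Bs \<in> polar K" "Bs \<bullet> B = 1"
    and D: "0 < det2 A B"
    and k: "sector_area K A B \<le> c * det2 A B / 2"
    and a: "a \<bullet> A = 1" "a \<bullet> B = 1"
  obtains q where "q \<in> K" "\<forall>x\<in>K. a \<bullet> x \<le> a \<bullet> q" "1 \<le> a \<bullet> q" "a \<bullet> q \<le> c" "q \<in> cone2 A B"
proof -
  have 0: "0 \<in> K" using K interior_subset by blast
  have bK: "bounded K" using K compact_imp_bounded by blast
  have "\<exists>q\<in>K. \<forall>x\<in>K. a \<bullet> x \<le> a \<bullet> q"
    using K A by (intro continuous_attains_sup) (auto intro!: continuous_intros)
  then obtain q0 where q0: "q0 \<in> K" "\<And>x. x \<in> K \<Longrightarrow> a \<bullet> x \<le> a \<bullet> q0" by blast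
  define \<alpha> \<beta> where "\<alpha> = det2 q0 B / det2 A B" and "\<beta> = det2 A q0 / det2 A B"
  have q0eq: "q0 = \<alpha> *\<^sub>R A + \<beta> *\<^sub>R B"
    unfolding \<alpha>_def \<beta>_def using D by (intro det2_expand') simp
  have aq0: "a \<bullet> q0 = \<alpha> + \<beta>" using a by (simp add: q0eq inner_add_right)
  have "\<exists>q\<in>K. q \<in> cone2 A B \<and> a \<bullet> q = a \<bullet> q0"
  proof (cases "0 \<le> \<alpha> \<and> 0 \<le> \<beta>")
    case True
    then have "q0 \<in> cone2 A B" unfolding q0eq by (intro cone2I) auto
    then show ?thesis using q0 by blast
  next
    case False
    have 1: "\<alpha> * (Bs \<bullet> A) + \<beta> \<le> 1" "\<alpha> + \<beta> * (As \<bullet> B) \<le> 1"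
      using polarD[OF B(2) q0(1)] polarD[OF A(2) q0(1)] A B by (simp_all add: q0eq inner_add_right)
    have 2: "Bs \<bullet> A \<le> 1" "As \<bullet> B \<le> 1" using A B polarD by auto
    have "\<alpha> + \<beta> \<le> 1"
    proof (cases "\<alpha> < 0")
      case True
      then have "\<alpha> * (1 - Bs \<bullet> A) \<le> 0" using 2 by (simp add: mult_nonpos_nonneg)
      then show ?thesis using 1 by (simp add: algebra_simps)
    next
      case False
      with \<open>\<not> (0 \<le> \<alpha> \<and> 0 \<le> \<beta>)\<close> have "\<beta> * (1 - As \<bullet> B) \<le> 0" using 2 by (simp add: mult_nonpos_nonneg)
      then show ?thesis using 1 by (simp add: algebra_simps)
    qed
    then have "a \<bullet> A = a \<bullet> q0" using q0(2)[OF A(1)] a aq0 by simp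
    then show ?thesis using A(1) cone2_left by blast
  qed
  then obtain q where q: "q \<in> K" "q \<in> cone2 A B" "a \<bullet> q = a \<bullet> q0" by blast
  have h1: "1 \<le> a \<bullet> q" using q0(2)[OF A(1)] a q by simp
  then have "q \<noteq> 0" by auto
  obtain s t where st: "0 \<le> s" "0 \<le> t" "q = s *\<^sub>R A + t *\<^sub>R B" using q(2) by (rule cone2E)
  have "(a \<bullet> q) * det2 A B / 2 = det2 A q / 2 + det2 q B / 2"
    using a by (simp add: st inner_add_right det2_linear algebra_simps)
  also have "\<dots> \<le> sector_area K A q + sector_area K q B"
    using sector_area_ge_triangle[OF K(1) bK 0, of 1 A 1 q] sector_area_ge_triangle[OF K(1) bK 0, of 1 q 1 B]
      A B q(1) abs_ge_self[of "det2 A q"] abs_ge_self[of "det2 q B"] by simp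
  also have "\<dots> \<le> c * det2 A B / 2"
    using sector_area_split[OF K(1) bK \<open>q \<noteq> 0\<close> q(2)] k by simp
  finally have "a \<bullet> q \<le> c" using D by simp
  then show ?thesis using that[of q] q q0 h1 by simp
qed

text \<open>Each generator satisfies the inequality: \<open>a\<close> because its value at
  \<open>q\<close> is at least that at \<open>x\<close> and \<open>\<rho> \<le> 1\<close>,
  \<open>m\<close> because \<open>\<rho>\<close> separates the two values. Nonnegative combinations
  inherit it.\<close>

lemma corner_support:
  assumes "v \<in> cone2 a m" "a \<bullet> x \<le> a \<bullet> q" "0 \<le> a \<bullet> q" "m \<bullet> x \<le> 1" "\<rho> \<le> m \<bullet> q" "0 \<le> \<rho>" "\<rho> \<le> 1"
  shows "v \<bullet> (\<rho> *\<^sub>R x) \<le> v \<bullet> q"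
proof -
  obtain s t where st: "0 \<le> s" "0 \<le> t" "v = s *\<^sub>R a + t *\<^sub>R m" using assms(1) by (rule cone2E)
  have "\<rho> * (a \<bullet> x) \<le> \<rho> * (a \<bullet> q)" "\<rho> * (a \<bullet> q) \<le> 1 * (a \<bullet> q)"
    using assms by (intro mult_left_mono mult_right_mono; simp)+
  then have "s * (\<rho> * (a \<bullet> x)) \<le> s * (a \<bullet> q)" using st by (intro mult_left_mono) auto
  moreover have "\<rho> * (m \<bullet> x) \<le> \<rho> * 1" using assms by (intro mult_left_mono)
  then have "t * (\<rho> * (m \<bullet> x)) \<le> t * (m \<bullet> q)" using st assms by (intro mult_left_mono) auto
  ultimately show ?thesis by (simp add: st inner_add_left algebra_simps)
qed

lemma cone2_split:
  assumes "m = x *\<^sub>R u + y *\<^sub>R v" "0 \<le> x" "0 \<le> y" "x + y = 1"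
  shows "cone2 u v \<subseteq> cone2 u m \<union> cone2 m v"
proof
  fix z assume "z \<in> cone2 u v"
  then obtain s t where st: "0 \<le> s" "0 \<le> t" "z = s *\<^sub>R u + t *\<^sub>R v" by (rule cone2E)
  show "z \<in> cone2 u m \<union> cone2 m v"
  proof (cases "t * x \<le> s * y")
    case True
    show ?thesis
    proof (cases "y = 0")
      case True
      then have "t = 0" using \<open>t * x \<le> s * y\<close> assms st by simp
      then show ?thesis using st cone2I[of s 0 u m] by simp
    next
      case False
      then have "z = (s - t * x / y) *\<^sub>R u + (t / y) *\<^sub>R m"
        by (simp add: st assms(1) algebra_simps)
      moreover have "0 \<le> s - t * x / y" "0 \<le> t / y"
        using False True assms st by (auto simp: field_simps)
      ultimately show ?thesis using cone2I by blast
    qed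
  next
    case False
    then have x: "0 < x" using assms(2-) st by (metis less_eq_real_def mult_nonneg_nonneg mult_zero_right)
    then have "z = (s / x) *\<^sub>R m + (t - s * y / x) *\<^sub>R v"
      by (simp add: st assms(1) algebra_simps)
    moreover have "0 \<le> t - s * y / x" "0 \<le> s / x"
      using False x st by (auto simp: field_simps)
    ultimately show ?thesis using cone2I by blast
  qed
qed

text \<open>Coordinates in the basis \<open>a\<close>, \<open>b\<close> may be shifted along the
  relation; cancelling the coordinate with the smaller ratio to its weight leaves the others
  nonnegative.\<close>

lemma three_cones_cover:
  assumes "det2 a b \<noteq> 0" "0 < r" "0 < s" "0 < t" "r *\<^sub>R a + s *\<^sub>R b + t *\<^sub>R c = 0"
  shows "v \<in> cone2 a b \<union> cone2 b c \<union> cone2 c a"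
proof -
  define x y where "x = det2 v b / det2 a b" and "y = det2 a v / det2 a b"
  have v: "v = x *\<^sub>R a + y *\<^sub>R b" unfolding x_def y_def by (rule det2_expand'[OF assms(1)])
  have shift: "v = (x + l * r) *\<^sub>R a + (y + l * s) *\<^sub>R b + (l * t) *\<^sub>R c" for l
  proof -
    have "(x + l * r) *\<^sub>R a + (y + l * s) *\<^sub>R b + (l * t) *\<^sub>R c = v + l *\<^sub>R (r *\<^sub>R a + s *\<^sub>R b + t *\<^sub>R c)"
      by (simp add: v algebra_simps)
    then show ?thesis by (simp add: assms)
  qed
  consider "0 \<le> x" "0 \<le> y" | "x < 0" "x / r \<le> y / s" | "y < 0" "y / s \<le> x / r"
    using assms by (smt (verit) divide_less_0_iff divide_nonneg_pos)
  then show ?thesis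
  proof cases
    case 1 then show ?thesis using v cone2I by blast
  next
    case 2
    have "0 \<le> y + (- x / r) * s" "0 \<le> (- x / r) * t" "x + (- x / r) * r = 0"
      using 2 assms by (auto simp: field_simps mult_le_0_iff)
    then show ?thesis using shift[of "- x / r"] cone2I[of "y + (- x / r) * s" "(- x / r) * t" b c] by simp
  next
    case 3
    have "0 \<le> x + (- y / s) * r" "0 \<le> (- y / s) * t" "y + (- y / s) * s = 0"
      using 3 assms by (auto simp: field_simps mult_le_0_iff)
    then show ?thesis using shift[of "- y / s"] cone2I[of "(- y / s) * t" "x + (- y / s) * r" c a]
      by (simp add: add.commute)
  qed
qed

lemma det2_cyclic: "det2 B C *\<^sub>R A + det2 C A *\<^sub>R B + det2 A B *\<^sub>R C = 0"
  by (simp add: real2_eq_iff det2_def algebra_simps)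

lemma inner_opposite:
  assumes "det2 B C \<noteq> 0" "a \<bullet> B = 1" "a \<bullet> C = 1"
  shows "a \<bullet> A = - ((det2 C A + det2 A B) / det2 B C)"
proof -
  have "a \<bullet> (det2 B C *\<^sub>R A + det2 C A *\<^sub>R B + det2 A B *\<^sub>R C) = 0" by (simp add: det2_cyclic)
  then have "det2 B C * (a \<bullet> A) = - (det2 C A + det2 A B)"
    using assms by (simp add: inner_add_right algebra_simps)
  then show ?thesis using assms by (simp add: field_simps)
qed

text \<open>\<open>a\<close> and \<open>b\<close> are two vertices of the triangle polar to
  \<open>ABC\<close>, and the numerator is twice the area of \<open>ABC\<close>. Summed cyclically,
  this yields the area of the polar triangle.\<close>

lemma det2_polar_vertices:
  assumes "0 < det2 A B" "0 < det2 B C" "0 < det2 C A"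
    and "a \<bullet> B = 1" "a \<bullet> C = 1" "b \<bullet> C = 1" "b \<bullet> A = 1"
  shows "det2 a b = (det2 A B + det2 B C + det2 C A) / (det2 B C * det2 C A)"
proof -
  have bB: "b \<bullet> B = - ((det2 A B + det2 B C) / det2 C A)"
    using inner_opposite[of C A b B] assms by simp
  have "det2 a b * det2 B C = 1 - b \<bullet> B"
    using assms det2_mult_det2[of a b B C] by simp
  also have "\<dots> = 1 + (det2 A B + det2 B C) / det2 C A"
    unfolding bB by simp
  also have "\<dots> = (det2 A B + det2 B C + det2 C A) / det2 C A"
    using assms by (simp add: field_simps)
  finally show ?thesis using assms by (simp add: field_simps)
qed

lemma polar_vertices_cyclic:
  assumes "0 < det2 A B" "0 < det2 B C" "0 < det2 C A"
    and "a \<bullet> B = 1" "a \<bullet> C = 1" "b \<bullet> C = 1" "b \<bullet> A = 1" "c \<bullet> A = 1" "c \<bullet> B = 1"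
  shows "det2 B C *\<^sub>R a + det2 C A *\<^sub>R b + det2 A B *\<^sub>R c = 0"
proof -
  have "b \<bullet> B = - ((det2 A B + det2 B C) / det2 C A)" "c \<bullet> C = - ((det2 B C + det2 C A) / det2 A B)"
    using inner_opposite[of C A b B] inner_opposite[of A B c C] assms by simp_all
  then show ?thesis
    using assms by (intro eq_if_inner_eq[of B C]) (auto simp: inner_add_left)
qed

text \<open>The forms with value 1 at \<open>C\<close> make up a line, on which the conditions at
  \<open>A\<close> and \<open>B\<close> cut out the edge from \<open>a\<close> to \<open>b\<close>
  of the polar triangle.\<close>

lemma touching_normal_decompose:
  assumes "0 < det2 A B" "0 < det2 B C" "0 < det2 C A"
    and "a \<bullet> B = 1" "a \<bullet> C = 1" "b \<bullet> C = 1" "b \<bullet> A = 1"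
    and m: "m \<bullet> C = 1" "m \<bullet> A \<le> 1" "m \<bullet> B \<le> 1"
  obtains x y where "0 \<le> x" "0 \<le> y" "x + y = 1" "m = x *\<^sub>R a + y *\<^sub>R b"
proof -
  define T where "T = det2 A B + det2 B C + det2 C A"
  have T: "0 < T" using assms by (simp add: T_def)
  define x y where "x = det2 B C / T * (1 - m \<bullet> A)" and "y = det2 C A / T * (1 - m \<bullet> B)"
  have "m \<bullet> (det2 B C *\<^sub>R A + det2 C A *\<^sub>R B + det2 A B *\<^sub>R C) = 0" by (simp add: det2_cyclic)
  then have "det2 B C * (1 - m \<bullet> A) + det2 C A * (1 - m \<bullet> B) = T"
    using m by (simp add: inner_add_right T_def algebra_simps)
  then have xy: "x + y = 1" using T by (simp add: x_def y_def flip: add_divide_distrib)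
  have aA: "a \<bullet> A = - ((det2 C A + det2 A B) / det2 B C)"
    using assms by (intro inner_opposite) auto
  have "m = x *\<^sub>R a + y *\<^sub>R b"
  proof (rule eq_if_inner_eq)
    show "det2 C A \<noteq> 0" using assms by simp
    show "m \<bullet> C = (x *\<^sub>R a + y *\<^sub>R b) \<bullet> C" using assms xy by (simp add: inner_add_left)
    have "(x *\<^sub>R a + y *\<^sub>R b) \<bullet> A = x * (a \<bullet> A) + y"
      using assms by (simp add: inner_add_left)
    also have "\<dots> = 1 - x * (1 - a \<bullet> A)"
      using xy by (simp add: right_diff_distrib)
    also have "1 - a \<bullet> A = T / det2 B C"
      unfolding aA T_def using assms by (simp add: field_simps)
    also have "x * (T / det2 B C) = 1 - m \<bullet> A"
      using T assms by (simp add: x_def)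
    finally show "m \<bullet> A = (x *\<^sub>R a + y *\<^sub>R b) \<bullet> A" by simp
  qed
  moreover have "0 \<le> x" "0 \<le> y" using assms T by (auto simp: x_def y_def)
  ultimately show ?thesis using that xy by blast
qed

text \<open>The excess \<open>G\<close> is symmetric in the ends of the side, so one
  \<open>q\<close> and one \<open>G\<close> serve both touching normals: \<open>sector_gain\<close>
  applies with \<open>\<sigma> = 1\<close> and, to the reversed side, with
  \<open>\<sigma> = -1\<close>.\<close>

lemma side_gain:
  fixes K :: "(real^2) set"
  assumes K: "convex K" "compact K" "0 \<in> interior K"
    and A: "A \<in> K" "As \<in> polar K" "As \<bullet> A = 1"
    and B: "B \<in> K" "Bs \<in> polar K" "Bs \<bullet> B = 1"
    and D: "0 < det2 A B"
    and k: "sector_area K A B \<le> c * det2 A B / 2"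
    and a: "a \<bullet> A = 1" "a \<bullet> B = 1"
  obtains q G where "q \<in> K" "\<forall>x\<in>K. a \<bullet> x \<le> a \<bullet> q" "0 \<le> a \<bullet> q"
    "G = sector_area (polar K) As a + sector_area (polar K) a Bs - (det2 As a + det2 a Bs) / (2 * c)" "0 \<le> G"
    "(1 - As \<bullet> q) * (1 - 1 / c) \<le> 4 * c * det2 A B * G"
    "(1 - Bs \<bullet> q) * (1 - 1 / c) \<le> 4 * c * det2 A B * G"
proof -
  obtain q where q: "q \<in> K" "\<forall>x\<in>K. a \<bullet> x \<le> a \<bullet> q" "1 \<le> a \<bullet> q" "a \<bullet> q \<le> c" "q \<in> cone2 A B"
    by (rule ex_sector_maximum[OF K A B D k a]) (rule that)
  define G where "G = sector_area (polar K) As a + sector_area (polar K) a Bs - (det2 As a + det2 a Bs) / (2 * c)"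
  have "(1 - As \<bullet> q) * (1 - 1 / c) \<le> 8 * (c * (1 * det2 A B / 2)) *
      (sector_area (polar K) As a + sector_area (polar K) a Bs - (1 * det2 As a + 1 * det2 a Bs) / (2 * c))"
    by (rule sector_gain[OF K _ A B _ _ refl a q(1) q(5)]) (use D k q(2) in auto)
  then have 1: "(1 - As \<bullet> q) * (1 - 1 / c) \<le> 4 * c * det2 A B * G"
    by (simp add: G_def)
  have "(1 - Bs \<bullet> q) * (1 - 1 / c) \<le> 8 * (c * ((- 1) * det2 B A / 2)) *
      (sector_area (polar K) Bs a + sector_area (polar K) a As - ((- 1) * det2 Bs a + (- 1) * det2 a As) / (2 * c))"
    by (rule sector_gain[OF K _ B A _ _ refl a(2,1) q(1)])
      (use D k q(2,5) in \<open>auto simp: cone2_commute[of B A] sector_area_commute[of K B A] det2_commute[of B A]\<close>)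
  also have "(- 1) * det2 Bs a + (- 1) * det2 a As = det2 As a + det2 a Bs"
    by (simp add: det2_def)
  also have "(- 1) * det2 B A = det2 A B"
    by (simp add: det2_def)
  also have "sector_area (polar K) Bs a + sector_area (polar K) a As = sector_area (polar K) As a + sector_area (polar K) a Bs"
    by (simp add: sector_area_commute[of _ a])
  finally have 2: "(1 - Bs \<bullet> q) * (1 - 1 / c) \<le> 4 * c * det2 A B * G"
    by (simp add: G_def)
  have c: "1 \<le> c" using q by simp
  have G0: "0 \<le> G"
  proof -
    have As: "As \<bullet> q \<le> 1" using A q polarD by blast
    have "0 \<le> (1 - As \<bullet> q) * (1 - 1 / c)" using As c by simp
    also note 1
    finally have "0 \<le> 4 * c * det2 A B * G" .
    moreover have "0 < 4 * c * det2 A B" using c D by simp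
    ultimately show ?thesis by (meson linorder_not_less mult_pos_neg)
  qed
  show ?thesis using that[of q G] q 1 2 G0 G_def by auto
qed

text \<open>The second bound says that the form equal to 1 on the line \<open>AB\<close> is at most
  \<open>c\<close> on \<open>K\<close>. With its rotations, \<open>K\<close> lies in
  \<open>c\<close> times the triangle \<open>ABC\<close>.\<close>

lemma balanced_triangle_scale:
  fixes K :: "(real^2) set"
  assumes K: "convex K" "compact K" "0 \<in> interior K" and bal: "balanced_triangle K A B C c" 
  shows "1 \<le> c" and "x \<in> K \<Longrightarrow> det2 A x + det2 x B \<le> c * det2 A B"
proof -
  obtain As Bs where A: "A \<in> K" "As \<in> polar K" "As \<bullet> A = 1" and B: "B \<in> K" "Bs \<in> polar K" "Bs \<bullet> B = 1"
    and D: "0 < det2 A B" and k: "sector_area K A B \<le> c * det2 A B / 2"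
    using bal by (auto simp: balanced_triangle_def)
  obtain a where a: "a \<bullet> A = 1" "a \<bullet> B = 1" using ex_inner_eq[of A B 1 1] D by auto
  obtain q where "q \<in> K" and q: "\<forall>x\<in>K. a \<bullet> x \<le> a \<bullet> q" "1 \<le> a \<bullet> q" "a \<bullet> q \<le> c" and "q \<in> cone2 A B"
    by (rule ex_sector_maximum[OF K A B D k a]) (rule that)
  show "1 \<le> c" using q by simp
  show "det2 A x + det2 x B \<le> c * det2 A B" if "x \<in> K"
  proof -
    have x: "x = (det2 x B / det2 A B) *\<^sub>R A + (det2 A x / det2 A B) *\<^sub>R B"
      using D by (intro det2_expand') simp
    have "a \<bullet> x = (det2 A x + det2 x B) / det2 A B"
      by (subst x) (simp add: inner_add_right a add_divide_distrib)
    moreover have "a \<bullet> x \<le> c" using bspec[OF q(1) that] q(3) by simp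
    ultimately show ?thesis using D by (simp add: pos_divide_le_eq)
  qed
qed

lemma balanced_triangle_rotate: "balanced_triangle K A B C c \<Longrightarrow> balanced_triangle K B C A c"
  by (auto simp: balanced_triangle_def algebra_simps)

text \<open>
  The points \<open>q1, q2, q3\<close> maximise the three linear forms that equal 1 on a side of the triangle, and
  \<open>\<rho>\<close> is the least value at one of them of a form touching \<open>K\<close> at an adjacent vertex. These six forms
  generate six cones covering the plane, whence \<open>\<rho> K\<close> lies in the hull of \<open>q1, q2, q3\<close>.
\<close>

lemma balanced_triangle_gain:
  fixes K :: "(real^2) set"
  assumes K: "convex K" "compact K" "0 \<in> interior K" and bal: "balanced_triangle K A B C c" 
  defines "S \<equiv> det2 A B + det2 B C + det2 C A"
  obtains q1 q2 q3 \<rho> where "{q1, q2, q3} \<subseteq> K" "\<rho> \<le> 1"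
    "S ^ 3 / (4 * (det2 A B * det2 B C * det2 C A)) + (1 - \<rho>) * (1 - 1 / c) / 8
       \<le> measure lebesgue K * measure lebesgue (polar K)"
    "0 \<le> \<rho> \<longrightarrow> (\<forall>x\<in>K. \<rho> *\<^sub>R x \<in> convex hull {q1, q2, q3})"
proof -
  obtain As Bs Cs where A: "A \<in> K" "As \<in> polar K" "As \<bullet> A = 1" and B: "B \<in> K" "Bs \<in> polar K" "Bs \<bullet> B = 1"
    and C: "C \<in> K" "Cs \<in> polar K" "Cs \<bullet> C = 1"
    and D: "0 < det2 A B" "0 < det2 B C" "0 < det2 C A"
    and k: "sector_area K A B \<le> c * det2 A B / 2" "sector_area K B C \<le> c * det2 B C / 2"
      "sector_area K C A \<le> c * det2 C A / 2"
    and mK: "measure lebesgue K = c * S / 2"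
    using bal by (auto simp: balanced_triangle_def S_def)
  have c: "1 \<le> c" using balanced_triangle_scale[OF K bal] by simp
  define DA DB DC where "DA = det2 B C" and "DB = det2 C A" and "DC = det2 A B"
  have Dpos: "0 < DA" "0 < DB" "0 < DC" using D by (auto simp: DA_def DB_def DC_def)
  have S: "S = DA + DB + DC" by (simp add: S_def DA_def DB_def DC_def)
  define N where "N = measure lebesgue (polar K)"
  obtain a where a: "a \<bullet> B = 1" "a \<bullet> C = 1" using ex_inner_eq[of B C 1 1] D by auto
  obtain b where b: "b \<bullet> C = 1" "b \<bullet> A = 1" using ex_inner_eq[of C A 1 1] D by auto
  obtain d where d: "d \<bullet> A = 1" "d \<bullet> B = 1" using ex_inner_eq[of A B 1 1] D by auto
  have P: "convex (polar K)" "bounded (polar K)"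
    using K by (auto simp: convex_polar bounded_polar)
  obtain q1 G1 where q1: "q1 \<in> K" "\<forall>x\<in>K. a \<bullet> x \<le> a \<bullet> q1" "0 \<le> a \<bullet> q1"
    "G1 = sector_area (polar K) Bs a + sector_area (polar K) a Cs - (det2 Bs a + det2 a Cs) / (2 * c)" "0 \<le> G1"
    "(1 - Bs \<bullet> q1) * (1 - 1 / c) \<le> 4 * c * det2 B C * G1"
    "(1 - Cs \<bullet> q1) * (1 - 1 / c) \<le> 4 * c * det2 B C * G1"
    by (rule side_gain[OF K B C D(2) k(2) a]) (rule that)
  obtain q2 G2 where q2: "q2 \<in> K" "\<forall>x\<in>K. b \<bullet> x \<le> b \<bullet> q2" "0 \<le> b \<bullet> q2"
    "G2 = sector_area (polar K) Cs b + sector_area (polar K) b As - (det2 Cs b + det2 b As) / (2 * c)" "0 \<le> G2"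
    "(1 - Cs \<bullet> q2) * (1 - 1 / c) \<le> 4 * c * det2 C A * G2"
    "(1 - As \<bullet> q2) * (1 - 1 / c) \<le> 4 * c * det2 C A * G2"
    by (rule side_gain[OF K C A D(3) k(3) b]) (rule that)
  obtain q3 G3 where q3: "q3 \<in> K" "\<forall>x\<in>K. d \<bullet> x \<le> d \<bullet> q3" "0 \<le> d \<bullet> q3"
    "G3 = sector_area (polar K) As d + sector_area (polar K) d Bs - (det2 As d + det2 d Bs) / (2 * c)" "0 \<le> G3"
    "(1 - As \<bullet> q3) * (1 - 1 / c) \<le> 4 * c * det2 A B * G3"
    "(1 - Bs \<bullet> q3) * (1 - 1 / c) \<le> 4 * c * det2 A B * G3"
    by (rule side_gain[OF K A B D(1) k(1) d]) (rule that)
  obtain xC yC where Cs: "0 \<le> xC" "0 \<le> yC" "xC + yC = 1" "Cs = xC *\<^sub>R a + yC *\<^sub>R b"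
    using touching_normal_decompose[OF D a b C(3)] polarD[OF C(2)] A B by metis
  obtain xA yA where As: "0 \<le> xA" "0 \<le> yA" "xA + yA = 1" "As = xA *\<^sub>R b + yA *\<^sub>R d"
    using touching_normal_decompose[OF D(2) D(3) D(1) b d A(3)] polarD[OF A(2)] B C by metis
  obtain xB yB where Bs: "0 \<le> xB" "0 \<le> yB" "xB + yB = 1" "Bs = xB *\<^sub>R d + yB *\<^sub>R a"
    using touching_normal_decompose[OF D(3) D(1) D(2) d a B(3)] polarD[OF B(2)] C A by metis
  have cones: "As \<in> cone2 b d" "Bs \<in> cone2 d a" "Cs \<in> cone2 a b"
    using As Bs Cs cone2I by blast+
  have nz: "As \<noteq> 0" "Bs \<noteq> 0" "Cs \<noteq> 0" using A B C by auto
  have dets: "det2 a b = S / (DA * DB)" "det2 b d = S / (DB * DC)" "det2 d a = S / (DC * DA)"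
    using det2_polar_vertices[OF D a b] det2_polar_vertices[OF D(2,3,1) b d]
      det2_polar_vertices[OF D(3,1,2) d a] by (simp_all add: S DA_def DB_def DC_def add_ac)
  have cyc: "DA *\<^sub>R a + DB *\<^sub>R b + DC *\<^sub>R d = 0"
    unfolding DA_def DB_def DC_def using D a b d by (intro polar_vertices_cyclic) auto
  have detab: "det2 a b \<noteq> 0" using Dpos by (simp add: dets S)
  \<comment> \<open>A point on the edge from \<open>u\<close> to \<open>v\<close> splits the
    triangle over that edge, so the touching normals drop out of the total area.\<close>
  have dsum: "det2 (u :: real^2) (x *\<^sub>R u + y *\<^sub>R v) + det2 (x *\<^sub>R u + y *\<^sub>R v) v = det2 u v" if "x + y = 1" for u v x y
  proof -
    have "det2 u (x *\<^sub>R u + y *\<^sub>R v) + det2 (x *\<^sub>R u + y *\<^sub>R v) v = (x + y) * det2 u v"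
      by (simp add: det2_linear algebra_simps)
    then show ?thesis using that by simp
  qed
  have "sector_area (polar K) a b + sector_area (polar K) b d + sector_area (polar K) d a \<le> N"
    unfolding N_def by (rule sector_area_three[OF P detab Dpos cyc])
  moreover have "sector_area (polar K) a Cs + sector_area (polar K) Cs b \<le> sector_area (polar K) a b"
    "sector_area (polar K) b As + sector_area (polar K) As d \<le> sector_area (polar K) b d"
    "sector_area (polar K) d Bs + sector_area (polar K) Bs a \<le> sector_area (polar K) d a"
    using sector_area_split[OF P] nz cones by auto
  ultimately have "G1 + G2 + G3 + ((det2 a Cs + det2 Cs b) + (det2 b As + det2 As d) + (det2 d Bs + det2 Bs a)) / (2 * c) \<le> N"
    unfolding q1(4) q2(4) q3(4) by (simp add: add_divide_distrib)
  also have "det2 a Cs + det2 Cs b = det2 a b" unfolding Cs(4) by (rule dsum[OF Cs(3)])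
  also have "det2 b As + det2 As d = det2 b d" unfolding As(4) by (rule dsum[OF As(3)])
  also have "det2 d Bs + det2 Bs a = det2 d a" unfolding Bs(4) by (rule dsum[OF Bs(3)])
  finally have N: "G1 + G2 + G3 + (det2 a b + det2 b d + det2 d a) / (2 * c) \<le> N" .
  have "det2 a b + det2 b d + det2 d a = S\<^sup>2 / (DA * DB * DC)"
    unfolding dets using Dpos by (simp add: field_simps S power2_eq_square)
  with N have N': "G1 + G2 + G3 + S\<^sup>2 / (DA * DB * DC) / (2 * c) \<le> N" by simp
  have S0: "0 < S" using Dpos S by simp
  have "c * S / 2 * (G1 + G2 + G3 + S\<^sup>2 / (DA * DB * DC) / (2 * c)) \<le> c * S / 2 * N"
    using N' c S0 by (intro mult_left_mono) auto
  moreover have "c * S / 2 * (S\<^sup>2 / (DA * DB * DC) / (2 * c)) = S ^ 3 / (4 * (DC * DA * DB))"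
    using c by (simp add: power2_eq_square power3_eq_cube mult_ac)
  ultimately have V: "c * S / 2 * (G1 + G2 + G3) + S ^ 3 / (4 * (DC * DA * DB)) \<le> measure lebesgue K * N"
    by (simp add: mK distrib_left)
  \<comment> \<open>The area of \<open>K\<close> times the total excess. Each determinant is at most
    \<open>S\<close> and each single excess at most the total, so this one number bounds the gain at
    every side.\<close>
  define \<Gamma> where "\<Gamma> = c * S / 2 * (G1 + G2 + G3)"
  have \<Gamma>: "4 * c * X * G \<le> 8 * \<Gamma>" if "0 \<le> X" "X \<le> S" "0 \<le> G" "G \<le> G1 + G2 + G3" for X G
  proof -
    have "X * G \<le> S * (G1 + G2 + G3)" using that S0 by (intro mult_mono) auto
    then have "4 * c * (X * G) \<le> 4 * c * (S * (G1 + G2 + G3))" using c by (intro mult_left_mono) auto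
    moreover have "8 * \<Gamma> = 4 * c * (S * (G1 + G2 + G3))" by (simp add: \<Gamma>_def)
    ultimately show ?thesis by (simp only: mult.assoc)
  qed
  have \<Gamma>123: "4 * c * DA * G1 \<le> 8 * \<Gamma>" "4 * c * DB * G2 \<le> 8 * \<Gamma>" "4 * c * DC * G3 \<le> 8 * \<Gamma>"
    using \<Gamma>[of DA G1] \<Gamma>[of DB G2] \<Gamma>[of DC G3] q1(5) q2(5) q3(5) Dpos S by simp_all
  define R where "R = {Bs \<bullet> q1, Cs \<bullet> q1, Cs \<bullet> q2, As \<bullet> q2, As \<bullet> q3, Bs \<bullet> q3}"
  define \<rho> where "\<rho> = Min R"
  have "\<rho> \<in> R" unfolding \<rho>_def by (rule Min_in) (auto simp: R_def)
  then have g: "(1 - \<rho>) * (1 - 1 / c) \<le> 8 * \<Gamma>" and \<rho>1: "\<rho> \<le> 1"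
    using q1 q2 q3 \<Gamma>123[unfolded DA_def DB_def DC_def] A B C polarD by (auto simp: R_def)
  have \<rho>le: "\<rho> \<le> r" if "r \<in> R" for r
    unfolding \<rho>_def using that by (intro Min_le) (auto simp: R_def)
  show ?thesis
  proof (rule that)
    show "{q1, q2, q3} \<subseteq> K" using q1 q2 q3 by auto
    show "\<rho> \<le> 1" by fact
    show "S ^ 3 / (4 * (det2 A B * det2 B C * det2 C A)) + (1 - \<rho>) * (1 - 1 / c) / 8
       \<le> measure lebesgue K * measure lebesgue (polar K)"
    proof -
      have "x / 8 \<le> y" if "x \<le> 8 * y" for x y :: real using that by simp
      from this[OF g] show ?thesis
        by (rule order_trans[OF add_left_mono], subst add.commute)
          (rule V[folded \<Gamma>_def, unfolded N_def DA_def DB_def DC_def])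
    qed
    show "0 \<le> \<rho> \<longrightarrow> (\<forall>x\<in>K. \<rho> *\<^sub>R x \<in> convex hull {q1, q2, q3})"
    proof (intro impI ballI)
      fix x assume \<rho>0: "0 \<le> \<rho>" and x: "x \<in> K"
      show "\<rho> *\<^sub>R x \<in> convex hull {q1, q2, q3}"
      proof (rule ccontr)
        assume nin: "\<rho> *\<^sub>R x \<notin> convex hull {q1, q2, q3}"
        have closed: "closed (convex hull {q1, q2, q3})"
          by (intro compact_imp_closed compact_convex_hull) simp
        obtain w \<beta> where w: "w \<bullet> (\<rho> *\<^sub>R x) < \<beta>" "\<forall>y\<in>convex hull {q1, q2, q3}. \<beta> < w \<bullet> y"
          using separating_hyperplane_closed_point[OF convex_convex_hull closed nin] by blast
        define v where "v = - w"
        have v: "v \<bullet> q < v \<bullet> (\<rho> *\<^sub>R x)" if "q \<in> {q1, q2, q3}" for q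
          using w(1) bspec[OF w(2) hull_inc[OF that]] unfolding v_def inner_minus_left by linarith
        have "v \<in> cone2 a b \<union> cone2 b d \<union> cone2 d a"
          by (rule three_cones_cover[OF detab Dpos cyc])
        then consider "v \<in> cone2 a Cs" | "v \<in> cone2 b Cs" | "v \<in> cone2 b As" | "v \<in> cone2 d As"
          | "v \<in> cone2 d Bs" | "v \<in> cone2 a Bs"
          using cone2_split[OF Cs(4,1-3)] cone2_split[OF As(4,1-3)] cone2_split[OF Bs(4,1-3)]
            cone2_commute[of Cs b] cone2_commute[of As d] cone2_commute[of Bs a] by blast
        then have "\<exists>q\<in>{q1, q2, q3}. v \<bullet> (\<rho> *\<^sub>R x) \<le> v \<bullet> q"
        proof cases
          case 1
          from corner_support[OF this bspec[OF q1(2) x] q1(3) polarD[OF C(2) x] _ \<rho>0 \<rho>1] show ?thesis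
            using \<rho>le by (auto simp: R_def)
        next
          case 2
          from corner_support[OF this bspec[OF q2(2) x] q2(3) polarD[OF C(2) x] _ \<rho>0 \<rho>1] show ?thesis
            using \<rho>le by (auto simp: R_def)
        next
          case 3
          from corner_support[OF this bspec[OF q2(2) x] q2(3) polarD[OF A(2) x] _ \<rho>0 \<rho>1] show ?thesis
            using \<rho>le by (auto simp: R_def)
        next
          case 4
          from corner_support[OF this bspec[OF q3(2) x] q3(3) polarD[OF A(2) x] _ \<rho>0 \<rho>1] show ?thesis
            using \<rho>le by (auto simp: R_def)
        next
          case 5
          from corner_support[OF this bspec[OF q3(2) x] q3(3) polarD[OF B(2) x] _ \<rho>0 \<rho>1] show ?thesis
            using \<rho>le by (auto simp: R_def)
        next
          case 6
          from corner_support[OF this bspec[OF q1(2) x] q1(3) polarD[OF B(2) x] _ \<rho>0 \<rho>1] show ?thesis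
            using \<rho>le by (auto simp: R_def)
        qed
        then show False using v by force
      qed
    qed
  qed
qed

section \<open>Restarting towards the midpoint of a side\<close>

text \<open>With every \<open>p\<close> replaced by 1/2 and every minus sign by plus, the
  determinant becomes half of a part of the expansion of
  \<open>(q1 + q2 + q3) * (r1 + r2 + r3)\<close>.\<close>

lemma det3_bound:
  fixes p1 p2 p3 q1 q2 q3 r1 r2 r3 :: real
  assumes "p1 \<le> 1/2" "p2 \<le> 1/2" "p3 \<le> 1/2" "0 \<le> p1" "0 \<le> p2" "0 \<le> p3"
    and "0 \<le> q1" "0 \<le> q2" "0 \<le> q3" "q1 + q2 + q3 = 1"
    and "0 \<le> r1" "0 \<le> r2" "0 \<le> r3" "r1 + r2 + r3 = 1"
  shows "p1 * (q2 * r3 - q3 * r2) + p2 * (q3 * r1 - q1 * r3) + p3 * (q1 * r2 - q2 * r1) \<le> 1/2"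
proof -
  have *: "p * (x - y) \<le> 1/2 * (x + y)" if "0 \<le> p" "p \<le> 1/2" "0 \<le> x" "0 \<le> y" for p x y :: real
  proof -
    have "p * (x - y) \<le> p * (x + y)" using that by (intro mult_left_mono) auto
    also have "\<dots> \<le> 1/2 * (x + y)" using that by (intro mult_right_mono) auto
    finally show ?thesis .
  qed
  have "p1 * (q2 * r3 - q3 * r2) + p2 * (q3 * r1 - q1 * r3) + p3 * (q1 * r2 - q2 * r1)
    \<le> 1/2 * (q2 * r3 + q3 * r2) + 1/2 * (q3 * r1 + q1 * r3) + 1/2 * (q1 * r2 + q2 * r1)"
    using assms by (intro add_mono * mult_nonneg_nonneg) auto
  also have "\<dots> \<le> 1/2 * (q2 * r3 + q3 * r2) + 1/2 * (q3 * r1 + q1 * r3) + 1/2 * (q1 * r2 + q2 * r1)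
      + 1/2 * (q1 * r1 + q2 * r2 + q3 * r3)" using assms by simp
  also have "\<dots> = 1/2 * ((q1 + q2 + q3) * (r1 + r2 + r3))" by (simp add: algebra_simps)
  finally show ?thesis using assms by simp
qed

lemma det2_sum_barycentric:
  fixes A B C :: "real^2" and p1 p2 p3 q1 q2 q3 r1 r2 r3 :: real
  assumes "p1 + p2 + p3 = 1" "q1 + q2 + q3 = 1" "r1 + r2 + r3 = 1"
  defines "X \<equiv> p1 *\<^sub>R A + p2 *\<^sub>R B + p3 *\<^sub>R C"
    and "Y \<equiv> q1 *\<^sub>R A + q2 *\<^sub>R B + q3 *\<^sub>R C"
    and "Z \<equiv> r1 *\<^sub>R A + r2 *\<^sub>R B + r3 *\<^sub>R C"
  shows "det2 X Y + det2 Y Z + det2 Z X =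
    (p1 * (q2 * r3 - q3 * r2) + p2 * (q3 * r1 - q1 * r3) + p3 * (q1 * r2 - q2 * r1)) *
    (det2 A B + det2 B C + det2 C A)"
proof -
  have e: "p3 = 1 - p1 - p2" "q3 = 1 - q1 - q2" "r3 = 1 - r1 - r2" using assms by auto
  show ?thesis
    unfolding X_def Y_def Z_def det2_def vector_add_component vector_scaleR_component real_scaleR_def e by algebra
qed

section \<open>Banach-Mazur distance to a triangle\<close>

text \<open>
  \<open>K\<close> lies in \<open>c\<close> times the triangle \<open>ABC\<close>. A point of \<open>K\<close> in the direction of the midpoint of \<open>BC\<close> has
  all barycentric coordinates at most 1/2 there, so a triangle in \<open>K\<close> with this vertex covers at most
  half of the enlarged triangle; hence restarting from it improves a small \<open>c\<close>.
\<close>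

lemma balanced_triangle_improve:
  fixes K :: "(real^2) set"
  assumes K: "convex K" "compact K" "0 \<in> interior K" and bal: "balanced_triangle K A B C c"
  defines "S \<equiv> det2 A B + det2 B C + det2 C A"
  assumes half: "det2 A B < S / 2" "det2 B C < S / 2" "det2 C A < S / 2"
  obtains A' B' C' c' where "balanced_triangle K A' B' C' c'" "2 \<le> c * c'"
proof -
  have D: "0 < det2 A B" "0 < det2 B C" "0 < det2 C A"
    using bal by (auto simp: balanced_triangle_def)
  have c: "1 \<le> c" using balanced_triangle_scale[OF K bal] by simp
  have S: "0 < S" using D by (simp add: S_def)
  have sub: "det2 A x + det2 x B \<le> c * det2 A B" "det2 B x + det2 x C \<le> c * det2 B C"
    "det2 C x + det2 x A \<le> c * det2 C A" if "x \<in> K" for x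
    using balanced_triangle_scale(2)[OF K _ that] bal balanced_triangle_rotate by blast+
  have "B + C \<noteq> 0"
  proof
    assume "B + C = 0"
    then have "det2 B (B + C) = 0" by simp
    then show False using D by (simp add: det2_linear)
  qed
  then obtain A' B' C' c' s where bal': "balanced_triangle K A' B' C' c'" and s: "0 < s" "A' = s *\<^sub>R (B + C)"
    using ex_balanced_triangle[OF K] by metis
  \<comment> \<open>\<open>p\<close>, \<open>q\<close>, \<open>r\<close> are the barycentric
    coordinates of \<open>x / c\<close> with respect to \<open>ABC\<close>; they are nonnegative
    because \<open>K\<close> lies in \<open>c\<close> times the triangle.\<close>
  define p where "p x = det2 B C / S - (det2 B x + det2 x C) / (c * S)" for x
  define q where "q x = det2 C A / S - (det2 C x + det2 x A) / (c * S)" for x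
  define r where "r x = det2 A B / S - (det2 A x + det2 x B) / (c * S)" for x
  have nonneg: "0 \<le> p x" "0 \<le> q x" "0 \<le> r x" if "x \<in> K" for x
    using sub[OF that] c S by (auto simp: p_def q_def r_def field_simps)
  have sum1: "p x + q x + r x = 1" for x
  proof -
    have "(det2 B x + det2 x C) + (det2 C x + det2 x A) + (det2 A x + det2 x B) = 0"
      by (simp add: det2_def)
    then have "p x + q x + r x = (det2 B C + det2 C A + det2 A B) / S"
      unfolding p_def q_def r_def using c S by (simp flip: add_divide_distrib diff_divide_distrib add: algebra_simps)
    then show ?thesis using S by (simp add: S_def add_ac)
  qed
  have bary: "x = c *\<^sub>R (p x *\<^sub>R A + q x *\<^sub>R B + r x *\<^sub>R C)" for x
  proof -
    have "S *\<^sub>R x + ((det2 B x + det2 x C) *\<^sub>R A + (det2 C x + det2 x A) *\<^sub>R B + (det2 A x + det2 x B) *\<^sub>R C) = 0"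
      unfolding S_def real2_eq_iff det2_def by (simp add: algebra_simps)
    then have 1: "(det2 B x + det2 x C) *\<^sub>R A + (det2 C x + det2 x A) *\<^sub>R B + (det2 A x + det2 x B) *\<^sub>R C = - (S *\<^sub>R x)"
      by (metis add.commute eq_neg_iff_add_eq_0)
    have e: "c * S * p x = c * det2 B C - (det2 B x + det2 x C)" "c * S * q x = c * det2 C A - (det2 C x + det2 x A)"
      "c * S * r x = c * det2 A B - (det2 A x + det2 x B)"
      using c S by (simp_all add: p_def q_def r_def right_diff_distrib)
    have "(c * S) *\<^sub>R (p x *\<^sub>R A + q x *\<^sub>R B + r x *\<^sub>R C)
        = c *\<^sub>R (det2 B C *\<^sub>R A + det2 C A *\<^sub>R B + det2 A B *\<^sub>R C)
          - ((det2 B x + det2 x C) *\<^sub>R A + (det2 C x + det2 x A) *\<^sub>R B + (det2 A x + det2 x B) *\<^sub>R C)"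
      unfolding scaleR_add_right scaleR_scaleR e by (simp add: algebra_simps)
    also have "\<dots> = S *\<^sub>R x" unfolding 1 det2_cyclic by simp
    finally have "S *\<^sub>R (c *\<^sub>R (p x *\<^sub>R A + q x *\<^sub>R B + r x *\<^sub>R C)) = S *\<^sub>R x"
      by (simp add: mult.commute)
    with S show ?thesis by (metis less_irrefl scaleR_left_imp_eq)
  qed
  have K': "A' \<in> K" "B' \<in> K" "C' \<in> K" and D': "0 < det2 A' B'" "0 < det2 B' C'" "0 < det2 C' A'"
    using bal' by (auto simp: balanced_triangle_def)
  define S' where "S' = det2 A' B' + det2 B' C' + det2 C' A'"
  have S': "0 < S'" using D' by (simp add: S'_def)
  \<comment> \<open>\<open>A' / c\<close> is \<open>w\<close> times \<open>B + C\<close>. Its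
    coordinates vary linearly from those of the origin (\<open>w = 0\<close>) to
    \<open>(0, 1/2, 1/2)\<close>, the midpoint of \<open>BC\<close> (\<open>w = 1/2\<close>); at
    both ends they are at most 1/2.\<close>
  define w where "w = s / c"
  have pA': "p A' = (det2 B C - 2 * w * det2 B C) / S"
    using c S by (simp add: p_def s w_def det2_linear field_simps)
  have qA': "q A' = (det2 C A + w * (S - 2 * det2 C A)) / S"
  proof -
    have "det2 C A' + det2 A' A = - (s * (S - 2 * det2 C A))"
      by (simp add: s det2_def S_def algebra_simps)
    then show ?thesis by (simp add: q_def w_def add_divide_distrib)
  qed
  have rA': "r A' = (det2 A B + w * (S - 2 * det2 A B)) / S"
  proof -
    have "det2 A A' + det2 A' B = - (s * (S - 2 * det2 A B))"
      by (simp add: s det2_def S_def algebra_simps)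
    then show ?thesis by (simp add: r_def w_def add_divide_distrib)
  qed
  have sc: "0 < w" using s c by (simp add: w_def)
  have "0 \<le> det2 B C * (1 - 2 * w) / S"
    using nonneg(1)[OF K'(1)] by (simp add: pA' algebra_simps)
  then have "0 \<le> 1 - 2 * w" using D S by (simp add: zero_le_divide_iff zero_le_mult_iff)
  then have sc2: "w \<le> 1 / 2" by linarith
  have "p A' \<le> 1 / 2" 
  proof -
    have "det2 B C - 2 * w * det2 B C \<le> det2 B C" using sc D by simp
    then show ?thesis using half S by (simp add: pA' field_simps)
  qed
  moreover have "q A' \<le> 1 / 2"
  proof -
    have "w * (S - 2 * det2 C A) \<le> 1 / 2 * (S - 2 * det2 C A)"
      using sc2 half by (intro mult_right_mono) auto
    then show ?thesis using S by (simp add: qA' field_simps)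
  qed
  moreover have "r A' \<le> 1 / 2"
  proof -
    have "w * (S - 2 * det2 A B) \<le> 1 / 2 * (S - 2 * det2 A B)"
      using sc2 half by (intro mult_right_mono) auto
    then show ?thesis using S by (simp add: rA' field_simps)
  qed
  ultimately have "p A' * (q B' * r C' - r B' * q C') + q A' * (r B' * p C' - p B' * r C') + r A' * (p B' * q C' - q B' * p C') \<le> 1 / 2"
    using nonneg K' sum1 by (intro det3_bound) auto
  moreover have "S' = c\<^sup>2 * ((p A' * (q B' * r C' - r B' * q C') + q A' * (r B' * p C' - p B' * r C') + r A' * (p B' * q C' - q B' * p C')) * S)"
  proof -
    let ?X = "\<lambda>x. p x *\<^sub>R A + q x *\<^sub>R B + r x *\<^sub>R C"
    have "S' = c\<^sup>2 * (det2 (?X A') (?X B') + det2 (?X B') (?X C') + det2 (?X C') (?X A'))"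
      unfolding S'_def by (subst (1 2 3 4 5 6) bary) (simp only: det2_scaleR power2_eq_square distrib_left mult.assoc)
    also have "det2 (?X A') (?X B') + det2 (?X B') (?X C') + det2 (?X C') (?X A') =
      (p A' * (q B' * r C' - r B' * q C') + q A' * (r B' * p C' - p B' * r C') + r A' * (p B' * q C' - q B' * p C')) * S"
      unfolding S_def by (rule det2_sum_barycentric) (rule sum1)+
    finally show ?thesis .
  qed
  ultimately have "S' \<le> c\<^sup>2 * (1 / 2 * S)"
    using S by (metis mult_left_mono mult_right_mono less_imp_le zero_le_power2)
  \<comment> \<open>Both sides are twice the area of \<open>K\<close>.\<close>
  moreover have cc': "c' * S' = c * S"
    using bal bal' by (simp add: balanced_triangle_def S_def S'_def)
  moreover have "0 < c'" using bal' by (simp add: balanced_triangle_def)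
  ultimately have "c' * (c\<^sup>2 * (1 / 2 * S)) \<ge> c * S"
    by (metis less_imp_le mult_left_mono)
  then have "c * S * 2 \<le> c * S * (c * c')" by (simp add: power2_eq_square mult_ac)
  then have "2 \<le> c * c'" using c S by simp
  then show ?thesis using that bal' by blast
qed

lemma not_collinear_det2:
  fixes a b c :: "real^2"
  assumes "\<not> collinear {a, b, c}"
  shows "det2 (b - a) (c - a) \<noteq> 0"
proof
  assume 0: "det2 (b - a) (c - a) = 0"
  have "collinear {0, b - a, c - a}"
  proof (cases "b = a")
    case False
    define u v where "u = b - a" and "v = c - a"
    have "u \<noteq> 0" and d: "det2 u v = 0" using 0 False by (auto simp: u_def v_def)
    have "(u \<bullet> u) *\<^sub>R v = (u \<bullet> v) *\<^sub>R u"
      using d unfolding real2_eq_iff inner_real2 det2_def vector_scaleR_component real_scaleR_def by algebra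
    moreover have "u \<bullet> u \<noteq> 0" using \<open>u \<noteq> 0\<close> by simp
    ultimately have "v = ((u \<bullet> v) / (u \<bullet> u)) *\<^sub>R u"
      by (metis (no_types, opaque_lifting) divide_inverse_commute scaleR_left_imp_eq scaleR_one scaleR_scaleR left_inverse)
    then show ?thesis unfolding collinear_lemma u_def[symmetric] v_def[symmetric] by blast
  qed (simp add: collinear_lemma)
  then show False using assms collinear_3[of b a c] by (simp add: insert_commute)
qed

lemma convex_hull_affine_image_3:
  assumes "linear f"
  shows "(\<lambda>y. f y + b) ` (convex hull {x, y, z}) = convex hull {f x + b, f y + b, f z + b}"
proof -
  have "(\<lambda>y. f y + b) ` (convex hull {x, y, z}) = (\<lambda>y. b + y) ` (f ` (convex hull {x, y, z}))"
    by (simp add: image_image add.commute)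
  also have "\<dots> = convex hull ((\<lambda>y. b + y) ` (f ` {x, y, z}))"
    by (simp only: convex_hull_translation convex_hull_linear_image[OF assms])
  finally show ?thesis by (simp add: add.commute)
qed

text \<open>The map carries \<open>q1\<close>, \<open>q2\<close>, \<open>q3\<close> to the vertices
  of \<open>T\<close>. It exists because a degenerate hull would confine the interior of
  \<open>K\<close> to a null set.\<close>

lemma ex_banach_mazur_map:
  fixes K T :: "(real^2) set"
  assumes K: "convex K" "interior K \<noteq> {}" and T: "is_triangle T" and s: "1 \<le> s"
    and q: "{q1, q2, q3} \<subseteq> K" and sub: "K \<subseteq> (\<lambda>y. s *\<^sub>R y + z) ` (convex hull {q1, q2, q3})"
  shows "\<exists>A x. invertible_affine A \<and> T \<subseteq> A ` K \<and> A ` K \<subseteq> (\<lambda>y. s *\<^sub>R y + x) ` T"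
proof -
  obtain a b c where T: "\<not> collinear {a, b, c}" "T = convex hull {a, b, c}"
    using T by (auto simp: is_triangle_def)
  have Dt: "det2 (b - a) (c - a) \<noteq> 0" using not_collinear_det2[OF T(1)] .
  define u v where "u = q2 - q1" and "v = q3 - q1"
  define d where "d = det2 u v"
  have hull_nonneg: "measure lebesgue (convex hull {q1, q2, q3}) = \<bar>d\<bar> / 2"
  proof -
    have "measure lebesgue (convex hull {q1, q2, q3}) = measure lborel (convex hull {q1, q2, q3})"
      by (intro measure_completion) (auto intro!: borel_compact compact_convex_hull)
    also have "\<dots> = \<bar>d\<bar> / 2"
      by (subst content_triangle) (simp add: det2_def d_def u_def v_def algebra_simps)
    finally show ?thesis .
  qed
  have d: "d \<noteq> 0"
  proof
    assume "d = 0"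
    let ?I = "(\<lambda>y. s *\<^sub>R y + z) ` (convex hull {q1, q2, q3})"
    have "compact ?I" by (intro compact_continuous_image compact_convex_hull continuous_intros) auto
    moreover have "measure lebesgue ?I = 0"
      using measure_lebesgue_affine[of s z "convex hull {q1, q2, q3}"] hull_nonneg \<open>d = 0\<close> by simp
    ultimately have "negligible ?I" by (simp add: negligible_iff_measure lmeasurable_compact)
    moreover have "interior K \<subseteq> ?I" by (rule order_trans[OF interior_subset sub])
    ultimately have "negligible (interior K)" by (rule negligible_subset)
    then show False using K(2) open_not_negligible by blast
  qed
  define f where "f y = (det2 y v / d) *\<^sub>R (b - a) + (det2 u y / d) *\<^sub>R (c - a)" for y
  have lin: "linear f"
    by (rule linearI) (simp_all add: f_def det2_linear add_divide_distrib algebra_simps)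
  have fu: "f u = b - a" "f v = c - a" using d by (simp_all add: f_def d_def)
  have "inj f"
    unfolding linear_injective_0[OF lin]
  proof (intro allI impI)
    fix y assume 0: "f y = 0"
    have "det2 (f y) (c - a) = det2 y v / d * det2 (b - a) (c - a)"
      "det2 (b - a) (f y) = det2 u y / d * det2 (b - a) (c - a)"
      unfolding f_def by (simp_all add: det2_linear(1,2,5,6))
    with 0 have "det2 y v = 0" "det2 u y = 0" using Dt d by auto
    then show "y = 0" using det2_expand'[of u v y] d by (simp add: d_def)
  qed
  then have "bij f" using lin by (simp add: linear_injective_imp_surjective bij_def)
  define e where "e = a - f q1"
  define A where "A y = f y + e" for y
  have inv: "invertible_affine A" unfolding invertible_affine_def A_def using lin \<open>bij f\<close> by blast
  have fq: "f q1 + e = a" "f q2 + e = b" "f q3 + e = c"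
    using fu linear_diff[OF lin, of q2 q1] linear_diff[OF lin, of q3 q1]
    by (simp_all add: e_def u_def v_def algebra_simps)
  have AT: "A ` (convex hull {q1, q2, q3}) = T"
    unfolding A_def convex_hull_affine_image_3[OF lin] fq T(2) ..
  have "convex hull {q1, q2, q3} \<subseteq> K" using q K(1) by (rule hull_minimal)
  then have "T \<subseteq> A ` K" using AT by blast
  moreover have "A ` K \<subseteq> (\<lambda>y. s *\<^sub>R y + (f z + e - s *\<^sub>R e)) ` T"
  proof
    fix w assume "w \<in> A ` K"
    then obtain y where y: "y \<in> convex hull {q1, q2, q3}" "w = A (s *\<^sub>R y + z)" using sub by blast
    then have "w = s *\<^sub>R A y + (f z + e - s *\<^sub>R e)"
      by (simp add: A_def linear_add[OF lin] linear_scale[OF lin] algebra_simps)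
    then show "w \<in> (\<lambda>y. s *\<^sub>R y + (f z + e - s *\<^sub>R e)) ` T" using y AT by blast
  qed
  ultimately show ?thesis using inv by blast
qed

lemma banach_mazur_dist_le:
  fixes K T :: "(real^2) set"
  assumes "convex K" "interior K \<noteq> {}" "is_triangle T" "1 \<le> s"
    and "{q1, q2, q3} \<subseteq> K" "K \<subseteq> (\<lambda>y. s *\<^sub>R y + z) ` (convex hull {q1, q2, q3})"
  shows "1 \<le> banach_mazur_dist K T" and "banach_mazur_dist K T \<le> s"
proof -
  let ?B = "{t. t \<ge> 1 \<and> (\<exists>A x. invertible_affine A \<and> T \<subseteq> A ` K \<and> A ` K \<subseteq> (\<lambda>y. t *\<^sub>R y + x) ` T)}"
  \<comment> \<open>This also shows the set to be nonempty, without which a lower bound of its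
    elements would say nothing about \<open>Inf\<close>.\<close>
  have s: "s \<in> ?B" using ex_banach_mazur_map[OF assms] assms(4) by blast
  then have "1 \<le> Inf ?B" by (intro cInf_greatest) auto
  then show "1 \<le> banach_mazur_dist K T" by (simp add: banach_mazur_dist_def)
  have "Inf ?B \<le> s" using s by (intro cInf_lower bdd_belowI[of _ 1]) auto
  then show "banach_mazur_dist K T \<le> s" by (simp add: banach_mazur_dist_def)
qed

section \<open>Stability of the planar volume product\<close>

text \<open>
  With respect to an inscribed triangle of maximal area, all barycentric coordinates of points of \<open>K\<close>
  are at least -1.
\<close>

lemma banach_mazur_dist_bounds:
  fixes K T :: "(real^2) set"
  assumes K: "convex K" "compact K" "0 \<in> interior K" and T: "is_triangle T"
  shows "1 \<le> banach_mazur_dist K T" and "banach_mazur_dist K T \<le> 4"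
proof -
  define g :: "(real^2) \<times> (real^2) \<times> (real^2) \<Rightarrow> real"
    where "g = (\<lambda>(x, y, z). det2 (y - x) (z - x))"
  have cont: "continuous_on (K \<times> K \<times> K) g"
    unfolding g_def det2_def case_prod_unfold by (intro continuous_intros)
  have "compact (K \<times> K \<times> K)" "K \<times> K \<times> K \<noteq> {}" using K by (auto intro!: compact_Times)
  from continuous_attains_sup[OF this cont]
  obtain m where m: "m \<in> K \<times> K \<times> K" "\<forall>y\<in>K \<times> K \<times> K. g y \<le> g m"
    by (rule bexE)
  obtain q1 q2 q3 where meq: "m = (q1, q2, q3)" by (cases m) auto
  have q: "q1 \<in> K" "q2 \<in> K" "q3 \<in> K" using m meq by auto
  define D where "D = det2 (q2 - q1) (q3 - q1)"
  have max: "det2 (y - x) (z - x) \<le> D" if "x \<in> K" "y \<in> K" "z \<in> K" for x y z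
    using bspec[OF m(2), of "(x, y, z)"] that by (simp add: g_def meq D_def)
  have D: "0 < D"
  proof -
    \<comment> \<open>The direction is arbitrary: any balanced triangle has positive area, so the
      maximal one is nondegenerate.\<close>
    have "(axis 1 1 :: real^2) \<noteq> 0" by (simp add: axis_eq_0_iff)
    then obtain A B C c where "balanced_triangle K A B C c"
      using ex_balanced_triangle[OF K] by metis
    then have "0 < det2 A B + det2 B C + det2 C A" "A \<in> K" "B \<in> K" "C \<in> K"
      by (auto simp: balanced_triangle_def)
    moreover have "det2 A B + det2 B C + det2 C A = det2 (B - A) (C - A)"
      by (simp add: det2_def algebra_simps)
    ultimately show ?thesis using max[of A B C] by linarith
  qed
  have "K \<subseteq> (\<lambda>y. 4 *\<^sub>R y + (- (q1 + q2 + q3))) ` (convex hull {q1, q2, q3})"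
  proof
    fix x assume x: "x \<in> K"
    define \<alpha> \<beta> \<gamma> where "\<alpha> = det2 (q2 - x) (q3 - x) / D" and "\<beta> = det2 (x - q1) (q3 - q1) / D"
      and "\<gamma> = det2 (q2 - q1) (x - q1) / D"
    have "det2 (q3 - x) (q2 - x) \<le> D" "det2 (q3 - q1) (x - q1) \<le> D" "det2 (x - q1) (q2 - q1) \<le> D"
      using max q x by auto
    then have ge: "- 1 \<le> \<alpha>" "- 1 \<le> \<beta>" "- 1 \<le> \<gamma>"
      using D by (simp_all add: \<alpha>_def \<beta>_def \<gamma>_def det2_commute[of "q2 - x"] det2_commute[of "x - q1" "q3 - q1"]
          det2_commute[of "q2 - q1" "x - q1"] field_simps)
    have "det2 (q2 - x) (q3 - x) + det2 (x - q1) (q3 - q1) + det2 (q2 - q1) (x - q1) = D"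
      by (simp add: det2_def D_def algebra_simps)
    then have sum: "\<alpha> + \<beta> + \<gamma> = 1"
      using D by (simp add: \<alpha>_def \<beta>_def \<gamma>_def flip: add_divide_distrib)
    have "x - q1 = \<beta> *\<^sub>R (q2 - q1) + \<gamma> *\<^sub>R (q3 - q1)"
      unfolding \<beta>_def \<gamma>_def D_def using D by (intro det2_expand') (simp add: D_def)
    then have "x = (1 - \<beta> - \<gamma>) *\<^sub>R q1 + \<beta> *\<^sub>R q2 + \<gamma> *\<^sub>R q3"
      by (simp add: algebra_simps)
    moreover have "1 - \<beta> - \<gamma> = \<alpha>" using sum by simp
    ultimately have xeq: "x = \<alpha> *\<^sub>R q1 + \<beta> *\<^sub>R q2 + \<gamma> *\<^sub>R q3" by simp
    \<comment> \<open>Raising each coordinate by 1 makes it nonnegative and the sum 4, whence the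
      factor 4 and the translation by \<open>- (q1 + q2 + q3)\<close>.\<close>
    let ?y = "((\<alpha> + 1) / 4) *\<^sub>R q1 + ((\<beta> + 1) / 4) *\<^sub>R q2 + ((\<gamma> + 1) / 4) *\<^sub>R q3"
    have "(\<alpha> + 1) / 4 + (\<beta> + 1) / 4 + (\<gamma> + 1) / 4 = (\<alpha> + \<beta> + \<gamma> + 3) / 4"
      by (simp add: add_divide_distrib)
    then have "(\<alpha> + 1) / 4 + (\<beta> + 1) / 4 + (\<gamma> + 1) / 4 = 1" by (simp add: sum)
    moreover have "0 \<le> (\<alpha> + 1) / 4" "0 \<le> (\<beta> + 1) / 4" "0 \<le> (\<gamma> + 1) / 4" using ge by auto
    ultimately have "?y \<in> convex hull {q1, q2, q3}" unfolding convex_hull_3 by blast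
    moreover have "4 *\<^sub>R ?y = (\<alpha> + 1) *\<^sub>R q1 + (\<beta> + 1) *\<^sub>R q2 + (\<gamma> + 1) *\<^sub>R q3"
    proof -
      have "4 * ((t + 1) / 4) = t + 1" for t :: real by simp
      then show ?thesis by (simp only: scaleR_add_right scaleR_scaleR)
    qed
    then have "x = 4 *\<^sub>R ?y + (- (q1 + q2 + q3))"
      by (simp add: xeq scaleR_add_left)
    ultimately show "x \<in> (\<lambda>y. 4 *\<^sub>R y + (- (q1 + q2 + q3))) ` (convex hull {q1, q2, q3})" by blast
  qed
  then show "1 \<le> banach_mazur_dist K T" "banach_mazur_dist K T \<le> 4"
    using banach_mazur_dist_le[of K T 4 q1 q2 q3] K T q by auto
qed

lemma cube_sum_ge_27_prod:
  fixes x y z :: real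
  assumes "0 < x" "0 < y" "0 < z"
  shows "27 * (x * y * z) \<le> (x + y + z) ^ 3"
proof -
  have "(x + y + z) ^ 3 - 27 * (x * y * z) = (x + y + z) * ((x - y)\<^sup>2 + (y - z)\<^sup>2 + (z - x)\<^sup>2) / 2
      + 3 * (x * (y - z)\<^sup>2 + y * (z - x)\<^sup>2 + z * (x - y)\<^sup>2)"
    by (simp add: power2_eq_square power3_eq_cube field_simps)
  also have "\<dots> \<ge> 0" using assms by simp
  finally show ?thesis by simp
qed

text \<open>For a fixed sum \<open>u = x + y\<close> the product is largest at \<open>x = y\<close>,
  and then the difference has the factor \<open>z - u\<close>. Divided by 4, the constant becomes
  the bound 8 for the volume product.\<close>

lemma cube_sum_ge_32_prod:
  fixes x y z :: real
  assumes "0 < x" "0 < y" "x + y \<le> z"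
  shows "32 * (x * y * z) \<le> (x + y + z) ^ 3"
proof -
  define u where "u = x + y"
  have u: "0 < u" "u \<le> z" using assms by (auto simp: u_def)
  have "4 * (x * y) \<le> u\<^sup>2"
    using zero_le_power2[of "x - y"] by (simp add: u_def power2_eq_square algebra_simps)
  then have "8 * z * (4 * (x * y)) \<le> 8 * z * u\<^sup>2" using u by (intro mult_left_mono) auto
  moreover have "(u + z) ^ 3 - 8 * z * u\<^sup>2 = (z - u) * (z\<^sup>2 + 3 * (u * z) + u * (z - u))"
    by (simp add: power2_eq_square power3_eq_cube algebra_simps)
  moreover have "0 \<le> (z - u) * (z\<^sup>2 + 3 * (u * z) + u * (z - u))"
    using u by (intro mult_nonneg_nonneg add_nonneg_nonneg) auto
  ultimately have "8 * z * (4 * (x * y)) \<le> (u + z) ^ 3" by linarith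
  then show ?thesis by (simp add: u_def mult_ac)
qed

theorem volume_product_stability:
  fixes K T :: "(real^2) set"
  assumes K: "convex K" "compact K" "0 \<in> interior K" and T: "is_triangle T"
  shows "27 / 4 * (1 + (banach_mazur_dist K T - 1) / 900) \<le> measure lebesgue K * measure lebesgue (polar K)"
proof -
  define \<delta> where "\<delta> = banach_mazur_dist K T"
  define V where "V = measure lebesgue K * measure lebesgue (polar K)"
  have \<delta>: "1 \<le> \<delta>" "\<delta> \<le> 4" using banach_mazur_dist_bounds[OF K T] by (auto simp: \<delta>_def)
  have goal_8: ?thesis if "8 \<le> V"
  proof -
    have "(\<delta> - 1) / 900 \<le> 3 / 900" using \<delta> by (intro divide_right_mono) auto
    then have "27 / 4 * (1 + (\<delta> - 1) / 900) \<le> 27 / 4 * (1 + 3 / 900)"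
      by (intro mult_left_mono add_left_mono) auto
    also have "\<dots> \<le> 8" by simp
    also note that
    finally show ?thesis by (simp only: \<delta>_def V_def)
  qed
  have gain: ?thesis if bal: "balanced_triangle K A B C c" and c: "4 / 3 \<le> c" for A B C c
  proof -
    define S where "S = det2 A B + det2 B C + det2 C A"
    obtain q1 q2 q3 \<rho> where q: "{q1, q2, q3} \<subseteq> K" and \<rho>: "\<rho> \<le> 1"
      and V: "S ^ 3 / (4 * (det2 A B * det2 B C * det2 C A)) + (1 - \<rho>) * (1 - 1 / c) / 8 \<le> V"
      and sub: "0 \<le> \<rho> \<longrightarrow> (\<forall>x\<in>K. \<rho> *\<^sub>R x \<in> convex hull {q1, q2, q3})"
      by (rule balanced_triangle_gain[OF K bal, folded S_def V_def]) (rule that)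
    have D: "0 < det2 A B" "0 < det2 B C" "0 < det2 C A"
      using bal by (auto simp: balanced_triangle_def)
    have "27 / 4 \<le> S ^ 3 / (4 * (det2 A B * det2 B C * det2 C A))"
      using cube_sum_ge_27_prod[OF D] D by (simp add: S_def field_simps)
    moreover have "(1 - \<rho>) / 32 \<le> (1 - \<rho>) * (1 - 1 / c) / 8"
    proof -
      have "1 / c \<le> 3 / 4" using c by (simp add: field_simps)
      then have "(1 - \<rho>) * (1 / 4) \<le> (1 - \<rho>) * (1 - 1 / c)" using \<rho> by (intro mult_left_mono) auto
      moreover have "(1 - \<rho>) / 32 = (1 - \<rho>) * (1 / 4) / 8" by simp
      ultimately show ?thesis by (simp only: divide_right_mono zero_le_numeral)
    qed
    ultimately have V': "27 / 4 + (1 - \<rho>) / 32 \<le> V"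
      by (rule order_trans[OF add_mono V])
    show ?thesis
    proof (rule ccontr)
      assume "\<not> ?thesis"
      then have "V < 27 / 4 * (1 + (\<delta> - 1) / 900)" by (simp add: \<delta>_def V_def)
      \<comment> \<open>\<open>6 / 25\<close> is \<open>32 * (27 / 4) / 900\<close>; with
        \<open>\<delta> \<le> 4\<close> it keeps \<open>\<rho>\<close> above 0.28.\<close>
      then have less: "1 - \<rho> < 6 / 25 * (\<delta> - 1)" using V' by (simp add: field_simps)
      then have \<rho>0: "0 < \<rho>" using \<delta> by simp
      have "K \<subseteq> (\<lambda>y. (1 / \<rho>) *\<^sub>R y + 0) ` (convex hull {q1, q2, q3})"
      proof
        fix x assume "x \<in> K"
        then have "\<rho> *\<^sub>R x \<in> convex hull {q1, q2, q3}" using sub \<rho>0 by simp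
        moreover have "x = (1 / \<rho>) *\<^sub>R (\<rho> *\<^sub>R x) + 0" using \<rho>0 by simp
        ultimately show "x \<in> (\<lambda>y. (1 / \<rho>) *\<^sub>R y + 0) ` (convex hull {q1, q2, q3})" by blast
      qed
      moreover have "interior K \<noteq> {}" using K by auto
      moreover have "1 \<le> 1 / \<rho>" using \<rho> \<rho>0 by simp
      ultimately have "\<delta> \<le> 1 / \<rho>"
        unfolding \<delta>_def by (intro banach_mazur_dist_le(2)[OF K(1) _ T _ q])
      then have "\<delta> * \<rho> \<le> 1" using \<rho>0 by (simp add: field_simps)
      moreover have "31 - 6 * \<delta> < 25 * \<rho>" using less by simp
      then have "\<delta> * (31 - 6 * \<delta>) < \<delta> * (25 * \<rho>)" using \<delta> by (intro mult_strict_left_mono) auto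
      \<comment> \<open>The second root is \<open>25 / 6 = 900 / 216\<close>. It has to be at least
        the a priori bound 4, so a constant of 864 would just do.\<close>
      ultimately have "0 < (\<delta> - 1) * (6 * \<delta> - 25)" by (simp add: algebra_simps)
      moreover have "(\<delta> - 1) * (6 * \<delta> - 25) \<le> 0" using \<delta> by (intro mult_nonneg_nonpos) auto
      ultimately show False by simp
    qed
  qed
  have "(axis 1 1 :: real^2) \<noteq> 0" by (simp add: axis_eq_0_iff)
  then obtain A B C c where bal: "balanced_triangle K A B C c"
    using ex_balanced_triangle[OF K] by metis
  have D: "0 < det2 A B" "0 < det2 B C" "0 < det2 C A" "0 < c"
    using bal by (auto simp: balanced_triangle_def)
  define S where "S = det2 A B + det2 B C + det2 C A"
  show ?thesis
  \<comment> \<open>Divided by \<open>S\<close>, the three determinants are the barycentric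
    coordinates of the origin in \<open>ABC\<close>.\<close>
  proof (cases "det2 A B < S / 2 \<and> det2 B C < S / 2 \<and> det2 C A < S / 2")
    case True
    show ?thesis
    proof (cases "4 / 3 \<le> c")
      case True then show ?thesis using gain bal by blast
    next
      case False
      obtain A' B' C' c' where bal': "balanced_triangle K A' B' C' c'" "2 \<le> c * c'"
        using balanced_triangle_improve[OF K bal] True unfolding S_def by metis
      then have "0 < c'" by (simp add: balanced_triangle_def)
      then have "c * c' \<le> 4 / 3 * c'" using False by (intro mult_right_mono) auto
      then have "4 / 3 \<le> c'" using bal' by simp
      then show ?thesis using gain bal' by blast
    qed
  next
    case False
    then have "32 * (det2 A B * det2 B C * det2 C A) \<le> S ^ 3"
      using cube_sum_ge_32_prod[of "det2 A B" "det2 B C" "det2 C A"]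
        cube_sum_ge_32_prod[of "det2 B C" "det2 C A" "det2 A B"]
        cube_sum_ge_32_prod[of "det2 C A" "det2 A B" "det2 B C"] D
      by (auto simp: S_def not_less mult_ac add_ac)
    then have 8: "8 \<le> S ^ 3 / (4 * (det2 A B * det2 B C * det2 C A))"
      using D by (simp add: field_simps)
    obtain q1 q2 q3 \<rho> where "{q1, q2, q3} \<subseteq> K" and \<rho>: "\<rho> \<le> 1"
      and V: "S ^ 3 / (4 * (det2 A B * det2 B C * det2 C A)) + (1 - \<rho>) * (1 - 1 / c) / 8 \<le> V"
      and "0 \<le> \<rho> \<longrightarrow> (\<forall>x\<in>K. \<rho> *\<^sub>R x \<in> convex hull {q1, q2, q3})"
      by (rule balanced_triangle_gain[OF K bal, folded S_def V_def]) (rule that)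
    have "1 \<le> c" using balanced_triangle_scale[OF K bal] by simp
    then have "0 \<le> (1 - \<rho>) * (1 - 1 / c) / 8" using \<rho> by simp
    from order_trans[OF add_mono[OF 8 this] V] have "8 \<le> V" by simp
    then show ?thesis by (rule goal_8)
  qed
qed

section \<open>Gradient images\<close>

text \<open>
  If the slope \<open>p\<close> is so small that \<open>u x0 + p \<bullet> (x - x0) > 0\<close> on \<open>\<Omega>\<close>, the maximum of \<open>u - p\<close> is attained in the
  interior, so \<open>p\<close> is a gradient of \<open>u\<close>. These slopes contain every \<open>s < 1\<close> multiple of \<open>- u x0\<close> times the
  polar body; the limit \<open>s \<rightarrow> 1\<close> is taken at the end.
\<close>

lemma gradient_image_measure:
  fixes \<Omega> :: "(real^2) set" and u :: "real^2 \<Rightarrow> real"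
  assumes \<Omega>: "compact \<Omega>" "x0 \<in> interior \<Omega>"
    and u: "continuous_on \<Omega> u" "C2_on u (interior \<Omega>)" "\<forall>x\<in>frontier \<Omega>. u x = 0" "0 < u x0"
    and int: "set_integrable lebesgue (interior \<Omega>) (\<lambda>x. \<bar>det (hessian u x)\<bar>)"
  shows "(u x0)\<^sup>2 * measure lebesgue (polar ((\<lambda>x. x - x0) ` \<Omega>))
    \<le> (LINT x:interior \<Omega>|lebesgue. \<bar>det (hessian u x)\<bar>)"
proof -
  let ?U = "interior \<Omega>" and ?C = "polar ((\<lambda>x. x - x0) ` \<Omega>)"
  define g :: "real^2 \<Rightarrow> real^2" where "g x = (\<chi> i. partial_deriv i u x)" for x
  define g' :: "real^2 \<Rightarrow> real^2 \<Rightarrow> real^2"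
    where "g' x h = (\<chi> i. frechet_derivative (partial_deriv i u) (at x) h)" for x h
  have du: "(u has_derivative (\<lambda>h. g x \<bullet> h)) (at x)" if "x \<in> ?U" for x
  proof -
    have "u differentiable (at x)"
      using u(2) that by (simp add: C2_on_def C1_on_def differentiable_on_eq_differentiable_at)
    then have d: "(u has_derivative frechet_derivative u (at x)) (at x)"
      by (simp add: frechet_derivative_works)
    have "frechet_derivative u (at x) h = g x \<bullet> h" for h
    proof -
      interpret l: linear "frechet_derivative u (at x)" using d by (rule has_derivative_linear)
      have "h = h $ 1 *\<^sub>R axis 1 1 + h $ 2 *\<^sub>R axis 2 1"
        by (simp add: real2_eq_iff axis_def)
      then have "frechet_derivative u (at x) h = frechet_derivative u (at x) (h $ 1 *\<^sub>R axis 1 1 + h $ 2 *\<^sub>R axis 2 1)"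
        by simp
      also have "\<dots> = g x \<bullet> h"
        by (simp only: l.add l.scale) (simp add: inner_real2 g_def partial_deriv_def mult.commute)
      finally show ?thesis .
    qed
    then have "frechet_derivative u (at x) = (\<lambda>h. g x \<bullet> h)" by auto
    then show ?thesis using d by simp
  qed
  have dg: "(g has_derivative g' x) (at x within ?U)" if x: "x \<in> ?U" for x
  proof -
    have "(partial_deriv i u has_derivative frechet_derivative (partial_deriv i u) (at x)) (at x)" for i
    proof -
      have "partial_deriv i u differentiable (at x)"
        using u(2) x by (simp add: C2_on_def C1_on_def differentiable_on_eq_differentiable_at)
      then show ?thesis by (simp add: frechet_derivative_works)
    qed
    then have "((\<lambda>x. g x \<bullet> b) has_derivative (\<lambda>h. g' x h \<bullet> b)) (at x)" if "b \<in> Basis" for b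
      using that by (auto simp: Basis_vec_def inner_axis g_def g'_def)
    then have "(g has_derivative g' x) (at x)"
      by (subst has_derivative_componentwise_within) blast
    then show ?thesis by (rule has_derivative_at_withinI)
  qed
  \<comment> \<open>The index order in \<open>hessian\<close> is opposite to that of the Jacobian
    matrix of the gradient; the determinant is the same.\<close>
  have "matrix (g' x) = transpose (hessian u x)" for x
    by (simp add: matrix_def transpose_def hessian_def g'_def partial_deriv_def vec_eq_iff)
  then have det: "\<bar>det (matrix (g' x))\<bar> = \<bar>det (hessian u x)\<bar>" for x by simp
  have I: "(\<lambda>x. \<bar>det (hessian u x)\<bar>) integrable_on ?U"
    "(LINT x:?U|lebesgue. \<bar>det (hessian u x)\<bar>) = integral ?U (\<lambda>x. \<bar>det (hessian u x)\<bar>)"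
    using set_lebesgue_integral_eq_integral[OF int] by auto
  have U: "?U \<in> sets lebesgue" by simp
  \<comment> \<open>Area formula as an inequality: the image counts each slope once, the integral
    with multiplicity.\<close>
  have im: "g ` ?U \<in> lmeasurable" "measure lebesgue (g ` ?U) \<le> integral ?U (\<lambda>x. \<bar>det (hessian u x)\<bar>)"
    using measurable_differentiable_image[OF U dg] measure_differentiable_image[OF U dg] I(1)
    by (simp_all add: det)
  have surj: "p \<in> g ` ?U" if p: "\<And>x. x \<in> \<Omega> \<Longrightarrow> - u x0 < p \<bullet> (x - x0)" for p
  proof -
    have x0: "x0 \<in> \<Omega>" using \<Omega> interior_subset by blast
    have "\<exists>x\<in>\<Omega>. \<forall>y\<in>\<Omega>. u y - p \<bullet> y \<le> u x - p \<bullet> x"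
      using \<Omega> x0 by (intro continuous_attains_sup continuous_intros u) auto
    then obtain x where x: "x \<in> \<Omega>" "\<And>y. y \<in> \<Omega> \<Longrightarrow> u y - p \<bullet> y \<le> u x - p \<bullet> x" by blast
    have "x \<notin> frontier \<Omega>"
    proof
      assume "x \<in> frontier \<Omega>"
      then have "u x = 0" using u by blast
      then show False using x(2)[OF x0] p[OF x(1)] by (simp add: inner_diff_right)
    qed
    then have xU: "x \<in> ?U"
      using x(1) \<Omega> by (simp add: frontier_def compact_imp_closed)
    have "((\<lambda>y. u y - p \<bullet> y) has_derivative (\<lambda>h. g x \<bullet> h - p \<bullet> h)) (at x)"
      by (intro has_derivative_diff du xU has_derivative_inner_right has_derivative_ident)
    then have "(\<lambda>h. g x \<bullet> h - p \<bullet> h) = (\<lambda>h. 0)"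
      using x(2) interior_subset[of \<Omega>] by (intro differential_zero_maxmin[OF xU open_interior]) auto
    then have "(g x - p) \<bullet> (g x - p) = 0" by (metis inner_diff_left)
    then show ?thesis using xU by auto
  qed
  have "s * ((u x0)\<^sup>2 * measure lebesgue ?C) \<le> integral ?U (\<lambda>x. \<bar>det (hessian u x)\<bar>)"
    if s: "0 < s" "s < 1" for s
  proof -
    \<comment> \<open>Area scales with the square of the factor, so \<open>r\<close> produces
      \<open>s\<close>. The dilation below is negative because \<open>surj\<close> bounds
      \<open>p \<bullet> (x - x0)\<close> from below, the polar body from above.\<close>
    define r where "r = sqrt s"
    have r: "0 < r" "r < 1" "r\<^sup>2 = s" using s by (auto simp: r_def)
    have "(\<lambda>n. (- (u x0 * r)) *\<^sub>R n + 0) ` ?C \<subseteq> g ` ?U"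
    proof (intro image_subsetI surj)
      fix n x assume "n \<in> ?C" and x: "x \<in> \<Omega>"
      then have "n \<bullet> (x - x0) \<le> 1" by (auto simp: polar_def)
      then have "u x0 * r * (n \<bullet> (x - x0)) \<le> u x0 * r * 1" using u r by (intro mult_left_mono) auto
      also have "\<dots> < u x0" using u r by simp
      finally show "- u x0 < ((- (u x0 * r)) *\<^sub>R n + 0) \<bullet> (x - x0)" by simp
    qed
    moreover have "compact ?C"
    proof (rule compact_polar)
      have "(\<lambda>x. x - x0) ` ?U \<subseteq> interior ((\<lambda>x. x - x0) ` \<Omega>)"
        by (intro interior_maximal image_mono interior_subset open_translation_subtract) simp
      then show "0 \<in> interior ((\<lambda>x. x - x0) ` \<Omega>)" using \<Omega>(2) by force
    qed
    then have "compact ((\<lambda>n. (- (u x0 * r)) *\<^sub>R n + 0) ` ?C)"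
      by (intro compact_continuous_image continuous_intros)
    ultimately have "measure lebesgue ((\<lambda>n. (- (u x0 * r)) *\<^sub>R n + 0) ` ?C) \<le> measure lebesgue (g ` ?U)"
      using im(1) by (intro measure_mono_fmeasurable fmeasurableD[OF lmeasurable_compact])
    moreover have "measure lebesgue ((\<lambda>n. (- (u x0 * r)) *\<^sub>R n + 0) ` ?C) = s * ((u x0)\<^sup>2 * measure lebesgue ?C)"
      using u r by (subst measure_lebesgue_affine) (simp add: power_mult_distrib)
    ultimately show ?thesis using im by linarith
  qed
  then show ?thesis
    unfolding I(2) by (rule field_le_mult_one_interval)
qed

lemma invertible_affine_translate:
  assumes "invertible_affine A"
  shows "invertible_affine (\<lambda>x. A (x + a))"
proof -
  obtain f b where f: "linear f" "bij f" "A = (\<lambda>y. f y + b)"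
    using assms by (auto simp: invertible_affine_def)
  then have "(\<lambda>x. A (x + a)) = (\<lambda>x. f x + (f a + b))"
    by (simp add: linear_add add.assoc)
  then show ?thesis unfolding invertible_affine_def using f by blast
qed

lemma banach_mazur_dist_translate:
  "banach_mazur_dist ((\<lambda>x. x - a) ` K) L = banach_mazur_dist K L"
proof -
  have "(\<exists>A x. invertible_affine A \<and> L \<subseteq> A ` (\<lambda>x. x - a) ` K \<and> A ` (\<lambda>x. x - a) ` K \<subseteq> S x)
    \<longleftrightarrow> (\<exists>A x. invertible_affine A \<and> L \<subseteq> A ` K \<and> A ` K \<subseteq> S x)" (is "?l \<longleftrightarrow> ?r") for S :: "'a \<Rightarrow> 'a set"
  proof
    assume ?l
    then obtain A x where A: "invertible_affine A" "L \<subseteq> A ` (\<lambda>x. x - a) ` K" "A ` (\<lambda>x. x - a) ` K \<subseteq> S x" by blast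
    moreover have "A ` (\<lambda>x. x - a) ` K = (\<lambda>x. A (x + - a)) ` K" by (simp add: image_image)
    ultimately show ?r using invertible_affine_translate[OF A(1), of "- a"] by metis
  next
    assume ?r
    then obtain A x where A: "invertible_affine A" "L \<subseteq> A ` K" "A ` K \<subseteq> S x" by blast
    moreover have "A ` K = (\<lambda>x. A (x + a)) ` (\<lambda>x. x - a) ` K" by (simp add: image_image)
    ultimately show ?l using invertible_affine_translate[OF A(1), of a] by metis
  qed
  then show ?thesis by (simp only: banach_mazur_dist_def)
qed

theorem theorem1p1:
  fixes \<Omega> T :: "(real^2) set" and u :: "real^2 \<Rightarrow> real"
  defines "I \<equiv> (LINT x:interior \<Omega>|lebesgue. \<bar>det (hessian u x)\<bar>)"
  assumes "convex_body \<Omega>"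
    and "0 \<in> interior \<Omega>"
    and "concave_on \<Omega> u"
    and "continuous_on \<Omega> u"
    and "C2_on u (interior \<Omega>)"
    and "\<forall>x\<in>frontier \<Omega>. u x = 0"
    and "set_integrable lebesgue (interior \<Omega>) (\<lambda>x. \<bar>det (hessian u x)\<bar>)"
    and "0 < I"
    and "is_triangle T"
  shows "(4 / 27 * measure lebesgue \<Omega> * I - (SUP x\<in>\<Omega>. u x)\<^sup>2)
           / (4 / 27 * measure lebesgue \<Omega> * I)
         \<ge> (banach_mazur_dist \<Omega> T - 1) / (banach_mazur_dist \<Omega> T + 899)"
proof -
  have \<Omega>: "convex \<Omega>" "compact \<Omega>" "\<Omega> \<noteq> {}"
    using assms(2) by (auto simp: convex_body_def)
  note zero = assms(3) and cont = assms(5) and C2 = assms(6) and bd = assms(7)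
    and int = assms(8) and Ipos = assms(9) and T = assms(10)
  define \<delta> where "\<delta> = banach_mazur_dist \<Omega> T"
  define Q where "Q = 4 / 27 * measure lebesgue \<Omega> * I"
  have \<delta>: "1 \<le> \<delta>" unfolding \<delta>_def by (rule banach_mazur_dist_bounds(1)[OF \<Omega>(1,2) zero T])
  \<comment> \<open>A positive lower bound for the product of the two areas makes each factor
    nonzero.\<close>
  have "0 < measure lebesgue \<Omega>"
  proof -
    have "0 < 27 / 4 * (1 + (\<delta> - 1) / 900)"
      using \<delta> by (intro mult_pos_pos add_pos_nonneg) auto
    also have "\<dots> \<le> measure lebesgue \<Omega> * measure lebesgue (polar \<Omega>)"
      unfolding \<delta>_def by (rule volume_product_stability[OF \<Omega>(1,2) zero T])
    finally show ?thesis
      by (metis less_irrefl mult_zero_left zero_less_measure_iff)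
  qed
  then have Q: "0 < Q" using Ipos by (simp add: Q_def)
  obtain x0 where x0: "x0 \<in> \<Omega>" "\<forall>x\<in>\<Omega>. u x \<le> u x0"
    using continuous_attains_sup[OF \<Omega>(2,3) cont] by blast
  have M: "(SUP x\<in>\<Omega>. u x) = u x0"
    using x0 by (intro cSup_eq_maximum) auto
  \<comment> \<open>The claim with denominators cleared: \<open>(u x0)\<^sup>2 / Q\<close> is at
    most \<open>900 / (\<delta> + 899)\<close>.\<close>
  have key: "(u x0)\<^sup>2 * (\<delta> + 899) \<le> 900 * Q"
  proof (cases "u x0 = 0")
    case True
    then show ?thesis using Q by simp
  next
    case False
    \<comment> \<open>A compact set has a frontier point, where \<open>u\<close> vanishes; hence the
      maximum is nonnegative, and positive in this case.\<close>
    have "\<Omega> \<noteq> UNIV" using \<Omega>(2) not_compact_UNIV by blast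
    then have "frontier \<Omega> \<noteq> {}" using \<Omega>(3) by (rule frontier_not_empty[rotated])
    then obtain y where y: "y \<in> frontier \<Omega>" by blast
    then have "y \<in> \<Omega>" using \<Omega>(2) by (meson compact_imp_closed frontier_subset_closed subsetD)
    then have pos: "0 < u x0" using x0(2) bd y False by force
    have int0: "x0 \<in> interior \<Omega>"
    proof (rule ccontr)
      assume "x0 \<notin> interior \<Omega>"
      then have "x0 \<in> frontier \<Omega>" using x0(1) closure_subset by (auto simp: frontier_def)
      then show False using bd False by blast
    qed
    let ?K = "(\<lambda>x. x - x0) ` \<Omega>"
    have K: "convex ?K" "compact ?K" "0 \<in> interior ?K"
    proof -
      show "convex ?K" using \<Omega>(1) by (rule convex_translation_subtract)
      show "compact ?K" using \<Omega>(2) by (rule compact_translation_subtract)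
      show "0 \<in> interior ?K" using int0 by (simp add: interior_translation_subtract)
    qed
    have "27 / 4 * (1 + (\<delta> - 1) / 900) \<le> measure lebesgue \<Omega> * measure lebesgue (polar ?K)"
      using volume_product_stability[OF K T]
      by (simp add: \<delta>_def banach_mazur_dist_translate measure_translation_subtract)
    then have "(u x0)\<^sup>2 * (27 / 4 * (1 + (\<delta> - 1) / 900))
        \<le> (u x0)\<^sup>2 * (measure lebesgue \<Omega> * measure lebesgue (polar ?K))"
      by (rule mult_left_mono) simp
    also have "\<dots> = measure lebesgue \<Omega> * ((u x0)\<^sup>2 * measure lebesgue (polar ?K))"
      by simp
    also have "\<dots> \<le> measure lebesgue \<Omega> * I"
      unfolding I_def by (intro mult_left_mono gradient_image_measure \<Omega> int0 cont C2 bd pos int) simp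
    \<comment> \<open>\<open>3600 / 27\<close> is \<open>900 * (4 / 27)\<close>, which turns the
      right-hand side into \<open>900 * Q\<close>.\<close>
    finally have "3600 / 27 * ((u x0)\<^sup>2 * (27 / 4 * (1 + (\<delta> - 1) / 900))) \<le> 3600 / 27 * (measure lebesgue \<Omega> * I)"
      by (rule mult_left_mono) simp
    moreover have "27 / 4 * (1 + (\<delta> - 1) / 900) = 27 / 3600 * (\<delta> + 899)"
      by (simp add: field_simps)
    moreover have "3600 / 27 * ((u x0)\<^sup>2 * (27 / 3600 * (\<delta> + 899))) = (u x0)\<^sup>2 * (\<delta> + 899)"
      by simp
    moreover have "3600 / 27 * (measure lebesgue \<Omega> * I) = 900 * Q"
      by (simp add: Q_def)
    ultimately show ?thesis by (simp only:)
  qed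
  have "(\<delta> - 1) / (\<delta> + 899) \<le> (Q - (u x0)\<^sup>2) / Q"
    using key Q \<delta> by (simp add: divide_simps) (simp add: algebra_simps)
  then show ?thesis by (simp add: M Q_def \<delta>_def)
qed

end
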